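(* Fix a signature and an inductive definition set $\Phi$. Let $\mathrm{Pr}$ be a $\mathrm{CLKID}^\omega$ proof of $\Gamma\vdash\Delta$ in which every substitution used in an instance of $(\mathrm{Subst})$ is atomic. Then there is a $\mathrm{CLKID}^\omega$ proof of $\Gamma\vdash\Delta$ containing no instance of $(\mathrm{Subst})$ and using only inference rules that occur in $\mathrm{Pr}$.
   Context: A substitution (finite map from variables to terms) is atomic if its image contains only variables and constant symbols. Language. Terms are built from variables and function symbols of fixed arity (nullary ones are constants). Predicate symbols: equality $=$, ordinary predicate symbols $Q$, inductive predicate symbols $P$. Formulas: $\phi::=P(\vec t)\mid Q(\vec u)\mid t=u\mid\lnot\phi\mid\phi\vee\phi\mid\phi\wedge\phi\mid\phi\to\phi\mid\exists x.\phi\mid\forall x.\phi$, up to $\alpha$-equivalence. An inductive definition set $\Phi$ is a finite set of productions $\dfrac{Q_1(\vec{u_1}(\vec x))\ \cdots\ Q_n(\vec{u_n}(\vec x))\ P_1(\vec{t_1}(\vec x))\ \cdots\ P_m(\vec{t_m}(\vec x))}{P(\vec t(\vec x))}$. Sequents $\Gamma\vdash\Delta$ have finite sets of formulas on each side; $\phi[\theta]$ is capture-avoiding substitution. Rules of $\mathrm{CLKID}^\omega$: $(\mathrm{Axiom})$: $\Gamma\vdash\Delta$ if $\Gamma\cap\Delta\neq\emptyset$; $(=\mathrm{R})$: $\Gamma\vdash t=t,\Delta$; $(\mathrm{Wk})$; $(\mathrm{Cut})$: from $\Gamma\vdash\phi,\Delta$ and $\Gamma,\phi\vdash\Delta$ infer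 $\Gamma\vdash\Delta$; $(\mathrm{Subst})$: from $\Gamma\vdash\Delta$ infer $\Gamma[\theta]\vdash\Delta[\theta]$; standard LK rules for $\lnot,\vee,\wedge,\to$; $(\forall\mathrm{L})$, $(\exists\mathrm{R})$ with arbitrary witness term $t$; $(\forall\mathrm{R})$, $(\exists\mathrm{L})$ with fresh eigenvariable $y$; $(=\mathrm{L})$: from $\Gamma[u/x,t/y]\vdash\Delta[u/x,t/y]$ infer $\Gamma[t/x,u/y],t=u\vdash\Delta[t/x,u/y]$; $(\mathrm{UL})$: from $\Gamma,P(\vec u)\vdash\Delta$ one premise per production of $P$, namely $\Gamma,\vec u=\vec t(\vec y),Q_1(\vec{u_1}(\vec y)),\dots,P_m(\vec{t_m}(\vec y))\vdash\Delta$ with $\vec y$ fresh; $(\mathrm{UR})$: for a production, from $\Gamma\vdash Q_i(\vec{u_i}(\vec u)),\Delta$ and $\Gamma\vdash P_j(\vec{t_j}(\vec u)),\Delta$ for all $i,j$ infer $\Gamma\vdash P(\vec t(\vec u)),\Delta$. A pre-proof is a finite derivation tree whose leaves are axiom instances or buds, each bud being assigned a companion (an internal node labelled by the identical sequent). Paths follow conclusion-to-premise edges and bud-to-companion edges. A trace along a path $(e_i)$ is a sequence of occurrences $C_i$ of inductive atoms in the antecedents of $e_i$ where: if $e_i$ is the conclusion of $(\mathrm{UL})$ unfolding $C_i$, then $C_{i+1}$ is an inductive atom introduced by that unfolding and $i$ is a progressing point; otherwise $C_{i+1}$ is the occurrence corresponding to $C_i$. A proof is a pre-proof in which every infinite path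 has a tail with a trace having infinitely many progressing points (global trace condition). *)

theory Defs
  imports Main "HOL-Library.Finite_Map" "HOL-Library.Infinite_Set"
begin

text \<open>
  The domains of the three maps are the symbols of the signature, so a signature may lack any of
  the three kinds of symbols. Nullary function symbols are the constants.
\<close>

record ('f, 'q, 'p) signature =
  fun_ar :: "'f \<rightharpoonup> nat"
  ord_ar :: "'q \<rightharpoonup> nat"
  ind_ar :: "'p \<rightharpoonup> nat"

text \<open>
  Formulas up to alpha-equivalence are represented in locally nameless style: free variables
  are named (\<^term>\<open>Var\<close>), bound variables are de Bruijn indices (\<^term>\<open>Bnd\<close>). The terms
  and formulas of the language are those satisfying \<^term>\<open>wf_tm \<Sigma> 0\<close> and
  \<^term>\<open>wf_fm \<Sigma> 0\<close> below, which have no dangling index.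
\<close>

type_synonym var = nat

datatype 'f tm = Var var | Bnd nat | Fun 'f "'f tm list"

datatype ('f, 'q, 'p) fm =
    Ind 'p "'f tm list"
  | Ord 'q "'f tm list"
  | Eq "'f tm" "'f tm"
  | Neg "('f, 'q, 'p) fm"
  | Or "('f, 'q, 'p) fm" "('f, 'q, 'p) fm"
  | And "('f, 'q, 'p) fm" "('f, 'q, 'p) fm"
  | Imp "('f, 'q, 'p) fm" "('f, 'q, 'p) fm"
  | Exists "('f, 'q, 'p) fm"
  | Forall "('f, 'q, 'p) fm"

primrec wf_tm :: "('f, 'q, 'p) signature \<Rightarrow> nat \<Rightarrow> 'f tm \<Rightarrow> bool" where
  "wf_tm \<Sigma> n (Var x) \<longleftrightarrow> True"
| "wf_tm \<Sigma> n (Bnd k) \<longleftrightarrow> k < n"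
| "wf_tm \<Sigma> n (Fun f ts) \<longleftrightarrow> fun_ar \<Sigma> f = Some (length ts) \<and> list_all (wf_tm \<Sigma> n) ts"

primrec wf_fm :: "('f, 'q, 'p) signature \<Rightarrow> nat \<Rightarrow> ('f, 'q, 'p) fm \<Rightarrow> bool" where
  "wf_fm \<Sigma> n (Ind p ts) \<longleftrightarrow> ind_ar \<Sigma> p = Some (length ts) \<and> list_all (wf_tm \<Sigma> n) ts"
| "wf_fm \<Sigma> n (Ord q ts) \<longleftrightarrow> ord_ar \<Sigma> q = Some (length ts) \<and> list_all (wf_tm \<Sigma> n) ts"
| "wf_fm \<Sigma> n (Eq t u) \<longleftrightarrow> wf_tm \<Sigma> n t \<and> wf_tm \<Sigma> n u"
| "wf_fm \<Sigma> n (Neg \<phi>) \<longleftrightarrow> wf_fm \<Sigma> n \<phi>"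
| "wf_fm \<Sigma> n (Or \<phi> \<psi>) \<longleftrightarrow> wf_fm \<Sigma> n \<phi> \<and> wf_fm \<Sigma> n \<psi>"
| "wf_fm \<Sigma> n (And \<phi> \<psi>) \<longleftrightarrow> wf_fm \<Sigma> n \<phi> \<and> wf_fm \<Sigma> n \<psi>"
| "wf_fm \<Sigma> n (Imp \<phi> \<psi>) \<longleftrightarrow> wf_fm \<Sigma> n \<phi> \<and> wf_fm \<Sigma> n \<psi>"
| "wf_fm \<Sigma> n (Exists \<phi>) \<longleftrightarrow> wf_fm \<Sigma> (Suc n) \<phi>"
| "wf_fm \<Sigma> n (Forall \<phi>) \<longleftrightarrow> wf_fm \<Sigma> (Suc n) \<phi>"

primrec fv_tm :: "'f tm \<Rightarrow> var set" where
  "fv_tm (Var x) = {x}"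
| "fv_tm (Bnd k) = {}"
| "fv_tm (Fun f ts) = \<Union> (set (map fv_tm ts))"

primrec fv :: "('f, 'q, 'p) fm \<Rightarrow> var set" where
  "fv (Ind p ts) = \<Union> (fv_tm ` set ts)"
| "fv (Ord q ts) = \<Union> (fv_tm ` set ts)"
| "fv (Eq t u) = fv_tm t \<union> fv_tm u"
| "fv (Neg \<phi>) = fv \<phi>"
| "fv (Or \<phi> \<psi>) = fv \<phi> \<union> fv \<psi>"
| "fv (And \<phi> \<psi>) = fv \<phi> \<union> fv \<psi>"
| "fv (Imp \<phi> \<psi>) = fv \<phi> \<union> fv \<psi>"
| "fv (Exists \<phi>) = fv \<phi>"
| "fv (Forall \<phi>) = fv \<phi>"

text \<open>
  Simultaneous substitution for free variables. It is capture-avoiding whenever the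
  substituted terms have no dangling index, which is required at every use below.
\<close>

primrec sub_tm :: "(var \<Rightarrow> 'f tm) \<Rightarrow> 'f tm \<Rightarrow> 'f tm" where
  "sub_tm s (Var x) = s x"
| "sub_tm s (Bnd k) = Bnd k"
| "sub_tm s (Fun f ts) = Fun f (map (sub_tm s) ts)"

primrec sub :: "(var \<Rightarrow> 'f tm) \<Rightarrow> ('f, 'q, 'p) fm \<Rightarrow> ('f, 'q, 'p) fm" where
  "sub s (Ind p ts) = Ind p (map (sub_tm s) ts)"
| "sub s (Ord q ts) = Ord q (map (sub_tm s) ts)"
| "sub s (Eq t u) = Eq (sub_tm s t) (sub_tm s u)"
| "sub s (Neg \<phi>) = Neg (sub s \<phi>)"
| "sub s (Or \<phi> \<psi>) = Or (sub s \<phi>) (sub s \<psi>)"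
| "sub s (And \<phi> \<psi>) = And (sub s \<phi>) (sub s \<psi>)"
| "sub s (Imp \<phi> \<psi>) = Imp (sub s \<phi>) (sub s \<psi>)"
| "sub s (Exists \<phi>) = Exists (sub s \<phi>)"
| "sub s (Forall \<phi>) = Forall (sub s \<phi>)"

type_synonym 'f substitution = "(var, 'f tm) fmap"

definition sfun :: "'f substitution \<Rightarrow> var \<Rightarrow> 'f tm" where
  "sfun \<theta> x = (case fmlookup \<theta> x of None \<Rightarrow> Var x | Some t \<Rightarrow> t)"

definition wf_substitution :: "('f, 'q, 'p) signature \<Rightarrow> 'f substitution \<Rightarrow> bool" where
  "wf_substitution \<Sigma> \<theta> \<longleftrightarrow> (\<forall>t \<in> fmran' \<theta>. wf_tm \<Sigma> 0 t)"

definition atomic :: "('f, 'q, 'p) signature \<Rightarrow> 'f substitution \<Rightarrow> bool" where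
  "atomic \<Sigma> \<theta> \<longleftrightarrow>
    (\<forall>t \<in> fmran' \<theta>. (\<exists>x. t = Var x) \<or> (\<exists>c. fun_ar \<Sigma> c = Some 0 \<and> t = Fun c []))"

text \<open>
  \<^term>\<open>opn 0 t \<phi>\<close> is the instance of the body \<^term>\<open>\<phi>\<close> of a quantified formula at the term
  \<^term>\<open>t\<close>, i.e. what is written \<open>\<phi>[t/x]\<close> for a formula \<open>\<forall>x. \<phi>\<close> or \<open>\<exists>x. \<phi>\<close>.
\<close>

primrec opn_tm :: "nat \<Rightarrow> 'f tm \<Rightarrow> 'f tm \<Rightarrow> 'f tm" where
  "opn_tm n t (Var x) = Var x"
| "opn_tm n t (Bnd k) = (if k = n then t else Bnd k)"
| "opn_tm n t (Fun f ts) = Fun f (map (opn_tm n t) ts)"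

primrec opn :: "nat \<Rightarrow> 'f tm \<Rightarrow> ('f, 'q, 'p) fm \<Rightarrow> ('f, 'q, 'p) fm" where
  "opn n t (Ind p ts) = Ind p (map (opn_tm n t) ts)"
| "opn n t (Ord q ts) = Ord q (map (opn_tm n t) ts)"
| "opn n t (Eq u v) = Eq (opn_tm n t u) (opn_tm n t v)"
| "opn n t (Neg \<phi>) = Neg (opn n t \<phi>)"
| "opn n t (Or \<phi> \<psi>) = Or (opn n t \<phi>) (opn n t \<psi>)"
| "opn n t (And \<phi> \<psi>) = And (opn n t \<phi>) (opn n t \<psi>)"
| "opn n t (Imp \<phi> \<psi>) = Imp (opn n t \<phi>) (opn n t \<psi>)"
| "opn n t (Exists \<phi>) = Exists (opn (Suc n) t \<phi>)"
| "opn n t (Forall \<phi>) = Forall (opn (Suc n) t \<phi>)"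

record ('f, 'q, 'p) production =
  ord_prems :: "('q \<times> 'f tm list) list"
  ind_prems :: "('p \<times> 'f tm list) list"
  head_pred :: "'p"
  head_args :: "'f tm list"

definition ord_atoms ::
    "('f, 'q, 'p) production \<Rightarrow> (var \<Rightarrow> 'f tm) \<Rightarrow> ('f, 'q, 'p) fm list" where
  "ord_atoms r s = map (\<lambda>(q, ts). sub s (Ord q ts)) (ord_prems r)"

definition ind_atoms ::
    "('f, 'q, 'p) production \<Rightarrow> (var \<Rightarrow> 'f tm) \<Rightarrow> ('f, 'q, 'p) fm list" where
  "ind_atoms r s = map (\<lambda>(p, ts). sub s (Ind p ts)) (ind_prems r)"

definition head_atom ::
    "('f, 'q, 'p) production \<Rightarrow> (var \<Rightarrow> 'f tm) \<Rightarrow> ('f, 'q, 'p) fm" where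
  "head_atom r s = sub s (Ind (head_pred r) (head_args r))"

definition fv_prod :: "('f, 'q, 'p) production \<Rightarrow> var set" where
  "fv_prod r = \<Union> (fv ` (set (ord_atoms r Var) \<union> set (ind_atoms r Var) \<union> {head_atom r Var}))"

definition inductive_definition_set ::
    "('f, 'q, 'p) signature \<Rightarrow> ('f, 'q, 'p) production set \<Rightarrow> bool" where
  "inductive_definition_set \<Sigma> \<Phi> \<longleftrightarrow> finite \<Phi> \<and>
    (\<forall>r \<in> \<Phi>. \<forall>\<phi> \<in> set (ord_atoms r Var) \<union> set (ind_atoms r Var) \<union> {head_atom r Var}.
       wf_fm \<Sigma> 0 \<phi>)"

type_synonym ('f, 'q, 'p) sequent = "('f, 'q, 'p) fm set \<times> ('f, 'q, 'p) fm set"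

definition wf_sequent :: "('f, 'q, 'p) signature \<Rightarrow> ('f, 'q, 'p) sequent \<Rightarrow> bool" where
  "wf_sequent \<Sigma> S \<longleftrightarrow>
    finite (fst S) \<and> finite (snd S) \<and> (\<forall>\<phi> \<in> fst S \<union> snd S. wf_fm \<Sigma> 0 \<phi>)"

definition fv_set :: "('f, 'q, 'p) fm set \<Rightarrow> var set" where
  "fv_set \<Gamma> = \<Union> (fv ` \<Gamma>)"

text \<open>
  An element of this type is an instance of an inference rule, given by the parameters of the
  rule schema. The first two arguments are always the contexts \<open>\<Gamma>\<close> and \<open>\<Delta>\<close> of the schema; as
  sequents consist of sets, the principal formula may also belong to the context. In
  \<^term>\<open>Wk \<Gamma> \<Delta> \<Gamma>' \<Delta>'\<close> the premise is \<open>\<Gamma> \<turnstile> \<Delta>\<close> and the conclusion \<open>\<Gamma>' \<turnstile> \<Delta>'\<close>.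
  The last argument of \<open>UL\<close> lists the productions of the unfolded predicate, each with the
  renaming of its variables to the fresh variables; that of \<open>UR\<close> instantiates the variables
  of the production by arbitrary terms.
\<close>

datatype ('f, 'q, 'p) inference =
    Axiom "('f, 'q, 'p) fm set" "('f, 'q, 'p) fm set"
  | EqR "('f, 'q, 'p) fm set" "('f, 'q, 'p) fm set" "'f tm"
  | Wk "('f, 'q, 'p) fm set" "('f, 'q, 'p) fm set" "('f, 'q, 'p) fm set" "('f, 'q, 'p) fm set"
  | Cut "('f, 'q, 'p) fm set" "('f, 'q, 'p) fm set" "('f, 'q, 'p) fm"
  | Subst "('f, 'q, 'p) fm set" "('f, 'q, 'p) fm set" "'f substitution"
  | NegL "('f, 'q, 'p) fm set" "('f, 'q, 'p) fm set" "('f, 'q, 'p) fm"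
  | NegR "('f, 'q, 'p) fm set" "('f, 'q, 'p) fm set" "('f, 'q, 'p) fm"
  | OrL "('f, 'q, 'p) fm set" "('f, 'q, 'p) fm set" "('f, 'q, 'p) fm" "('f, 'q, 'p) fm"
  | OrR "('f, 'q, 'p) fm set" "('f, 'q, 'p) fm set" "('f, 'q, 'p) fm" "('f, 'q, 'p) fm"
  | AndL "('f, 'q, 'p) fm set" "('f, 'q, 'p) fm set" "('f, 'q, 'p) fm" "('f, 'q, 'p) fm"
  | AndR "('f, 'q, 'p) fm set" "('f, 'q, 'p) fm set" "('f, 'q, 'p) fm" "('f, 'q, 'p) fm"
  | ImpL "('f, 'q, 'p) fm set" "('f, 'q, 'p) fm set" "('f, 'q, 'p) fm" "('f, 'q, 'p) fm"
  | ImpR "('f, 'q, 'p) fm set" "('f, 'q, 'p) fm set" "('f, 'q, 'p) fm" "('f, 'q, 'p) fm"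
  | AllL "('f, 'q, 'p) fm set" "('f, 'q, 'p) fm set" "('f, 'q, 'p) fm" "'f tm"
  | AllR "('f, 'q, 'p) fm set" "('f, 'q, 'p) fm set" "('f, 'q, 'p) fm" var
  | ExL "('f, 'q, 'p) fm set" "('f, 'q, 'p) fm set" "('f, 'q, 'p) fm" var
  | ExR "('f, 'q, 'p) fm set" "('f, 'q, 'p) fm set" "('f, 'q, 'p) fm" "'f tm"
  | EqL "('f, 'q, 'p) fm set" "('f, 'q, 'p) fm set" var var "'f tm" "'f tm"
  | UL "('f, 'q, 'p) fm set" "('f, 'q, 'p) fm set" 'p "'f tm list"
      "(('f, 'q, 'p) production \<times> (var \<Rightarrow> var)) list"
  | UR "('f, 'q, 'p) fm set" "('f, 'q, 'p) fm set" "('f, 'q, 'p) production" "var \<Rightarrow> 'f tm"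

definition sub2 ::
    "var \<Rightarrow> 'f tm \<Rightarrow> var \<Rightarrow> 'f tm \<Rightarrow> ('f, 'q, 'p) fm \<Rightarrow> ('f, 'q, 'p) fm" where
  "sub2 x t y u = sub (sfun (fmap_of_list [(x, t), (y, u)]))"

fun concl :: "('f, 'q, 'p) inference \<Rightarrow> ('f, 'q, 'p) sequent" where
  "concl (Axiom \<Gamma> \<Delta>) = (\<Gamma>, \<Delta>)"
| "concl (EqR \<Gamma> \<Delta> t) = (\<Gamma>, insert (Eq t t) \<Delta>)"
| "concl (Wk \<Gamma> \<Delta> \<Gamma>' \<Delta>') = (\<Gamma>', \<Delta>')"
| "concl (Cut \<Gamma> \<Delta> \<phi>) = (\<Gamma>, \<Delta>)"
| "concl (Subst \<Gamma> \<Delta> \<theta>) = (sub (sfun \<theta>) ` \<Gamma>, sub (sfun \<theta>) ` \<Delta>)"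
| "concl (NegL \<Gamma> \<Delta> \<phi>) = (insert (Neg \<phi>) \<Gamma>, \<Delta>)"
| "concl (NegR \<Gamma> \<Delta> \<phi>) = (\<Gamma>, insert (Neg \<phi>) \<Delta>)"
| "concl (OrL \<Gamma> \<Delta> \<phi> \<psi>) = (insert (Or \<phi> \<psi>) \<Gamma>, \<Delta>)"
| "concl (OrR \<Gamma> \<Delta> \<phi> \<psi>) = (\<Gamma>, insert (Or \<phi> \<psi>) \<Delta>)"
| "concl (AndL \<Gamma> \<Delta> \<phi> \<psi>) = (insert (And \<phi> \<psi>) \<Gamma>, \<Delta>)"
| "concl (AndR \<Gamma> \<Delta> \<phi> \<psi>) = (\<Gamma>, insert (And \<phi> \<psi>) \<Delta>)"
| "concl (ImpL \<Gamma> \<Delta> \<phi> \<psi>) = (insert (Imp \<phi> \<psi>) \<Gamma>, \<Delta>)"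
| "concl (ImpR \<Gamma> \<Delta> \<phi> \<psi>) = (\<Gamma>, insert (Imp \<phi> \<psi>) \<Delta>)"
| "concl (AllL \<Gamma> \<Delta> \<phi> t) = (insert (Forall \<phi>) \<Gamma>, \<Delta>)"
| "concl (AllR \<Gamma> \<Delta> \<phi> y) = (\<Gamma>, insert (Forall \<phi>) \<Delta>)"
| "concl (ExL \<Gamma> \<Delta> \<phi> y) = (insert (Exists \<phi>) \<Gamma>, \<Delta>)"
| "concl (ExR \<Gamma> \<Delta> \<phi> t) = (\<Gamma>, insert (Exists \<phi>) \<Delta>)"
| "concl (EqL \<Gamma> \<Delta> x y t u) = (insert (Eq t u) (sub2 x t y u ` \<Gamma>), sub2 x t y u ` \<Delta>)"
| "concl (UL \<Gamma> \<Delta> p us rs) = (insert (Ind p us) \<Gamma>, \<Delta>)"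
| "concl (UR \<Gamma> \<Delta> r s) = (\<Gamma>, insert (head_atom r s) \<Delta>)"

definition unfolding_formulas ::
    "'f tm list \<Rightarrow> ('f, 'q, 'p) production \<Rightarrow> (var \<Rightarrow> 'f tm) \<Rightarrow> ('f, 'q, 'p) fm set" where
  "unfolding_formulas us r s =
    set (map2 Eq us (map (sub_tm s) (head_args r))) \<union> set (ord_atoms r s) \<union> set (ind_atoms r s)"

fun prems :: "('f, 'q, 'p) inference \<Rightarrow> ('f, 'q, 'p) sequent list" where
  "prems (Axiom \<Gamma> \<Delta>) = []"
| "prems (EqR \<Gamma> \<Delta> t) = []"
| "prems (Wk \<Gamma> \<Delta> \<Gamma>' \<Delta>') = [(\<Gamma>, \<Delta>)]"
| "prems (Cut \<Gamma> \<Delta> \<phi>) = [(\<Gamma>, insert \<phi> \<Delta>), (insert \<phi> \<Gamma>, \<Delta>)]"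
| "prems (Subst \<Gamma> \<Delta> \<theta>) = [(\<Gamma>, \<Delta>)]"
| "prems (NegL \<Gamma> \<Delta> \<phi>) = [(\<Gamma>, insert \<phi> \<Delta>)]"
| "prems (NegR \<Gamma> \<Delta> \<phi>) = [(insert \<phi> \<Gamma>, \<Delta>)]"
| "prems (OrL \<Gamma> \<Delta> \<phi> \<psi>) = [(insert \<phi> \<Gamma>, \<Delta>), (insert \<psi> \<Gamma>, \<Delta>)]"
| "prems (OrR \<Gamma> \<Delta> \<phi> \<psi>) = [(\<Gamma>, insert \<phi> (insert \<psi> \<Delta>))]"
| "prems (AndL \<Gamma> \<Delta> \<phi> \<psi>) = [(insert \<phi> (insert \<psi> \<Gamma>), \<Delta>)]"
| "prems (AndR \<Gamma> \<Delta> \<phi> \<psi>) = [(\<Gamma>, insert \<phi> \<Delta>), (\<Gamma>, insert \<psi> \<Delta>)]"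
| "prems (ImpL \<Gamma> \<Delta> \<phi> \<psi>) = [(\<Gamma>, insert \<phi> \<Delta>), (insert \<psi> \<Gamma>, \<Delta>)]"
| "prems (ImpR \<Gamma> \<Delta> \<phi> \<psi>) = [(insert \<phi> \<Gamma>, insert \<psi> \<Delta>)]"
| "prems (AllL \<Gamma> \<Delta> \<phi> t) = [(insert (opn 0 t \<phi>) \<Gamma>, \<Delta>)]"
| "prems (AllR \<Gamma> \<Delta> \<phi> y) = [(\<Gamma>, insert (opn 0 (Var y) \<phi>) \<Delta>)]"
| "prems (ExL \<Gamma> \<Delta> \<phi> y) = [(insert (opn 0 (Var y) \<phi>) \<Gamma>, \<Delta>)]"
| "prems (ExR \<Gamma> \<Delta> \<phi> t) = [(\<Gamma>, insert (opn 0 t \<phi>) \<Delta>)]"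
| "prems (EqL \<Gamma> \<Delta> x y t u) = [(sub2 x u y t ` \<Gamma>, sub2 x u y t ` \<Delta>)]"
| "prems (UL \<Gamma> \<Delta> p us rs) =
    map (\<lambda>(r, \<rho>). (\<Gamma> \<union> unfolding_formulas us r (Var \<circ> \<rho>), \<Delta>)) rs"
| "prems (UR \<Gamma> \<Delta> r s) = map (\<lambda>\<phi>. (\<Gamma>, insert \<phi> \<Delta>)) (ord_atoms r s @ ind_atoms r s)"

fun side_cond ::
    "('f, 'q, 'p) signature \<Rightarrow> ('f, 'q, 'p) production set \<Rightarrow> ('f, 'q, 'p) inference \<Rightarrow> bool" where
  "side_cond \<Sigma> \<Phi> (Axiom \<Gamma> \<Delta>) \<longleftrightarrow> \<Gamma> \<inter> \<Delta> \<noteq> {}"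
| "side_cond \<Sigma> \<Phi> (Wk \<Gamma> \<Delta> \<Gamma>' \<Delta>') \<longleftrightarrow> \<Gamma> \<subseteq> \<Gamma>' \<and> \<Delta> \<subseteq> \<Delta>'"
| "side_cond \<Sigma> \<Phi> (Subst \<Gamma> \<Delta> \<theta>) \<longleftrightarrow> wf_substitution \<Sigma> \<theta>"
| "side_cond \<Sigma> \<Phi> (AllL \<Gamma> \<Delta> \<phi> t) \<longleftrightarrow> wf_tm \<Sigma> 0 t"
| "side_cond \<Sigma> \<Phi> (AllR \<Gamma> \<Delta> \<phi> y) \<longleftrightarrow> y \<notin> fv_set (insert (Forall \<phi>) (\<Gamma> \<union> \<Delta>))"
| "side_cond \<Sigma> \<Phi> (ExL \<Gamma> \<Delta> \<phi> y) \<longleftrightarrow> y \<notin> fv_set (insert (Exists \<phi>) (\<Gamma> \<union> \<Delta>))"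
| "side_cond \<Sigma> \<Phi> (ExR \<Gamma> \<Delta> \<phi> t) \<longleftrightarrow> wf_tm \<Sigma> 0 t"
| "side_cond \<Sigma> \<Phi> (EqL \<Gamma> \<Delta> x y t u) \<longleftrightarrow> x \<noteq> y \<and> wf_sequent \<Sigma> (\<Gamma>, \<Delta>)"
| "side_cond \<Sigma> \<Phi> (UL \<Gamma> \<Delta> p us rs) \<longleftrightarrow>
    distinct (map fst rs) \<and> set (map fst rs) = {r \<in> \<Phi>. head_pred r = p} \<and>
    (\<forall>(r, \<rho>) \<in> set rs. inj_on \<rho> (fv_prod r) \<and>
       \<rho> ` fv_prod r \<inter> fv_set (insert (Ind p us) (\<Gamma> \<union> \<Delta>)) = {})"
| "side_cond \<Sigma> \<Phi> (UR \<Gamma> \<Delta> r s) \<longleftrightarrow> r \<in> \<Phi> \<and> (\<forall>x \<in> fv_prod r. wf_tm \<Sigma> 0 (s x))"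
| "side_cond \<Sigma> \<Phi> _ \<longleftrightarrow> True"

definition wf_inference ::
    "('f, 'q, 'p) signature \<Rightarrow> ('f, 'q, 'p) production set \<Rightarrow> ('f, 'q, 'p) inference \<Rightarrow> bool" where
  "wf_inference \<Sigma> \<Phi> i \<longleftrightarrow>
    side_cond \<Sigma> \<Phi> i \<and> wf_sequent \<Sigma> (concl i) \<and> (\<forall>S \<in> set (prems i). wf_sequent \<Sigma> S)"

datatype rule =
    R_Axiom | R_EqR | R_Wk | R_Cut | R_Subst | R_NegL | R_NegR | R_OrL | R_OrR | R_AndL | R_AndR
  | R_ImpL | R_ImpR | R_AllL | R_AllR | R_ExL | R_ExR | R_EqL | R_UL | R_UR

fun rule_of :: "('f, 'q, 'p) inference \<Rightarrow> rule" where
  "rule_of (Axiom _ _) = R_Axiom"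
| "rule_of (EqR _ _ _) = R_EqR"
| "rule_of (Wk _ _ _ _) = R_Wk"
| "rule_of (Cut _ _ _) = R_Cut"
| "rule_of (Subst _ _ _) = R_Subst"
| "rule_of (NegL _ _ _) = R_NegL"
| "rule_of (NegR _ _ _) = R_NegR"
| "rule_of (OrL _ _ _ _) = R_OrL"
| "rule_of (OrR _ _ _ _) = R_OrR"
| "rule_of (AndL _ _ _ _) = R_AndL"
| "rule_of (AndR _ _ _ _) = R_AndR"
| "rule_of (ImpL _ _ _ _) = R_ImpL"
| "rule_of (ImpR _ _ _ _) = R_ImpR"
| "rule_of (AllL _ _ _ _) = R_AllL"
| "rule_of (AllR _ _ _ _) = R_AllR"
| "rule_of (ExL _ _ _ _) = R_ExL"
| "rule_of (ExR _ _ _ _) = R_ExR"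
| "rule_of (EqL _ _ _ _ _ _) = R_EqL"
| "rule_of (UL _ _ _ _ _) = R_UL"
| "rule_of (UR _ _ _ _) = R_UR"

text \<open>
  The nodes of a derivation tree are addressed by lists of child numbers. A bud carries its
  sequent and the address, from the root of the whole tree, of the companion assigned to it.
\<close>

datatype ('f, 'q, 'p) deriv =
    Infer "('f, 'q, 'p) inference" "('f, 'q, 'p) deriv list"
  | Bud "('f, 'q, 'p) sequent" "nat list"

fun sequent_of :: "('f, 'q, 'p) deriv \<Rightarrow> ('f, 'q, 'p) sequent" where
  "sequent_of (Infer i ds) = concl i"
| "sequent_of (Bud S c) = S"

fun subtree :: "('f, 'q, 'p) deriv \<Rightarrow> nat list \<Rightarrow> ('f, 'q, 'p) deriv option" where
  "subtree d [] = Some d"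
| "subtree (Infer i ds) (k # v) = (if k < length ds then subtree (ds ! k) v else None)"
| "subtree (Bud S c) (k # v) = None"

text \<open>
  A leaf that is not a bud is an instance of a rule without premises: \<open>Axiom\<close>, \<open>EqR\<close>, \<open>UL\<close>
  for a predicate without productions, or \<open>UR\<close> for a production without premises.
\<close>

definition pre_proof ::
    "('f, 'q, 'p) signature \<Rightarrow> ('f, 'q, 'p) production set \<Rightarrow> ('f, 'q, 'p) deriv \<Rightarrow> bool" where
  "pre_proof \<Sigma> \<Phi> D \<longleftrightarrow>
    (\<forall>v i ds. subtree D v = Some (Infer i ds) \<longrightarrow>
       wf_inference \<Sigma> \<Phi> i \<and> map sequent_of ds = prems i) \<and>
    (\<forall>v S c. subtree D v = Some (Bud S c) \<longrightarrow>
       (\<exists>i ds. subtree D c = Some (Infer i ds) \<and> ds \<noteq> [] \<and> concl i = S))"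

definition edge :: "('f, 'q, 'p) deriv \<Rightarrow> nat list \<Rightarrow> nat list \<Rightarrow> bool" where
  "edge D v w \<longleftrightarrow>
    (\<exists>i ds k. subtree D v = Some (Infer i ds) \<and> k < length ds \<and> w = v @ [k]) \<or>
    (\<exists>S. subtree D v = Some (Bud S w))"

definition infinite_path :: "('f, 'q, 'p) deriv \<Rightarrow> (nat \<Rightarrow> nat list) \<Rightarrow> bool" where
  "infinite_path D v \<longleftrightarrow> (\<forall>n. edge D (v n) (v (Suc n)))"

fun progress_step ::
    "('f, 'q, 'p) inference \<Rightarrow> nat \<Rightarrow> ('f, 'q, 'p) fm \<Rightarrow> ('f, 'q, 'p) fm \<Rightarrow> bool" where
  "progress_step (UL \<Gamma> \<Delta> p us rs) k C C' \<longleftrightarrow>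
    C = Ind p us \<and> (case rs ! k of (r, \<rho>) \<Rightarrow> C' \<in> set (ind_atoms r (Var \<circ> \<rho>)))"
| "progress_step _ k C C' \<longleftrightarrow> False"

text \<open>
  \<^term>\<open>trace_step i k C C'\<close> relates an inductive atom of the antecedent of the conclusion of
  \<^term>\<open>i\<close> to one of the antecedent of the \<^term>\<open>k\<close>-th premise. In the rules covered by the
  last equation an inductive atom of the antecedent of the conclusion is never principal, so the
  occurrence corresponding to it is the same formula in the premise. In \<open>UL\<close> the unfolded atom
  may in addition be a member of the context \<open>\<Gamma>\<close>; that occurrence persists unchanged.
\<close>

fun trace_step ::
    "('f, 'q, 'p) inference \<Rightarrow> nat \<Rightarrow> ('f, 'q, 'p) fm \<Rightarrow> ('f, 'q, 'p) fm \<Rightarrow> bool" where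
  "trace_step (Subst \<Gamma> \<Delta> \<theta>) k C C' \<longleftrightarrow> C' \<in> \<Gamma> \<and> C = sub (sfun \<theta>) C'"
| "trace_step (EqL \<Gamma> \<Delta> x y t u) k C C' \<longleftrightarrow>
    (\<exists>\<phi> \<in> \<Gamma>. C = sub2 x t y u \<phi> \<and> C' = sub2 x u y t \<phi>)"
| "trace_step (UL \<Gamma> \<Delta> p us rs) k C C' \<longleftrightarrow>
    progress_step (UL \<Gamma> \<Delta> p us rs) k C C' \<or> (C \<in> \<Gamma> \<and> C' = C)"
| "trace_step _ k C C' \<longleftrightarrow> C' = C"

definition trace_edge ::
    "('f, 'q, 'p) deriv \<Rightarrow> nat list \<Rightarrow> nat list \<Rightarrow> ('f, 'q, 'p) fm \<Rightarrow> ('f, 'q, 'p) fm \<Rightarrow> bool" where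
  "trace_edge D v w C C' \<longleftrightarrow>
    (\<exists>i ds k. subtree D v = Some (Infer i ds) \<and> k < length ds \<and> w = v @ [k] \<and> trace_step i k C C') \<or>
    (\<exists>S. subtree D v = Some (Bud S w) \<and> C' = C)"

definition progress_edge ::
    "('f, 'q, 'p) deriv \<Rightarrow> nat list \<Rightarrow> nat list \<Rightarrow> ('f, 'q, 'p) fm \<Rightarrow> ('f, 'q, 'p) fm \<Rightarrow> bool" where
  "progress_edge D v w C C' \<longleftrightarrow>
    (\<exists>i ds k. subtree D v = Some (Infer i ds) \<and> k < length ds \<and> w = v @ [k] \<and> progress_step i k C C')"

definition ind_atom_at :: "('f, 'q, 'p) deriv \<Rightarrow> nat list \<Rightarrow> ('f, 'q, 'p) fm \<Rightarrow> bool" where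
  "ind_atom_at D v C \<longleftrightarrow>
    (\<exists>p ts. C = Ind p ts) \<and> (\<exists>d. subtree D v = Some d \<and> C \<in> fst (sequent_of d))"

definition trace ::
    "('f, 'q, 'p) deriv \<Rightarrow> (nat \<Rightarrow> nat list) \<Rightarrow> (nat \<Rightarrow> ('f, 'q, 'p) fm) \<Rightarrow> bool" where
  "trace D v C \<longleftrightarrow>
    (\<forall>n. ind_atom_at D (v n) (C n) \<and> trace_edge D (v n) (v (Suc n)) (C n) (C (Suc n)))"

definition infinitely_progressing ::
    "('f, 'q, 'p) deriv \<Rightarrow> (nat \<Rightarrow> nat list) \<Rightarrow> (nat \<Rightarrow> ('f, 'q, 'p) fm) \<Rightarrow> bool" where
  "infinitely_progressing D v C \<longleftrightarrow>
    (\<exists>\<^sub>\<infinity>n. progress_edge D (v n) (v (Suc n)) (C n) (C (Suc n)))"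

definition global_trace_condition :: "('f, 'q, 'p) deriv \<Rightarrow> bool" where
  "global_trace_condition D \<longleftrightarrow>
    (\<forall>v. infinite_path D v \<longrightarrow>
       (\<exists>m C. trace D (\<lambda>n. v (m + n)) C \<and> infinitely_progressing D (\<lambda>n. v (m + n)) C))"

definition clkid_proof ::
    "('f, 'q, 'p) signature \<Rightarrow> ('f, 'q, 'p) production set \<Rightarrow> ('f, 'q, 'p) deriv \<Rightarrow> bool" where
  "clkid_proof \<Sigma> \<Phi> D \<longleftrightarrow> pre_proof \<Sigma> \<Phi> D \<and> global_trace_condition D"

definition clkid_proof_of ::
    "('f, 'q, 'p) signature \<Rightarrow> ('f, 'q, 'p) production set \<Rightarrow> ('f, 'q, 'p) deriv \<Rightarrow>
     ('f, 'q, 'p) fm set \<Rightarrow> ('f, 'q, 'p) fm set \<Rightarrow> bool" where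
  "clkid_proof_of \<Sigma> \<Phi> D \<Gamma> \<Delta> \<longleftrightarrow> clkid_proof \<Sigma> \<Phi> D \<and> sequent_of D = (\<Gamma>, \<Delta>)"

definition inferences :: "('f, 'q, 'p) deriv \<Rightarrow> ('f, 'q, 'p) inference set" where
  "inferences D = {i. \<exists>v ds. subtree D v = Some (Infer i ds)}"

definition rules_used :: "('f, 'q, 'p) deriv \<Rightarrow> rule set" where
  "rules_used D = rule_of ` inferences D"

end

theory Submission
  imports Defs
begin

text \<open>
  A substitution \<open>\<theta>\<close> can be pushed up through every inference rule other than \<open>Subst\<close>, after renaming
  eigenvariables, and \<open>Subst\<close> with \<open>\<sigma>\<close> disappears when \<open>\<theta>\<close> is replaced by \<open>\<theta>\<sigma>\<close> above it. Since all
  \<open>\<sigma>\<close> are atomic, the accumulated substitutions can be kept in a finite set: they map the finitely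
  many variables of the proof to the constants that occur in the \<open>\<sigma>\<close> and to a finite pool of
  variables. So pairs of a node and a substitution form a finite graph, and this unfolds to a
  cyclic derivation. A path there is a path of the given proof with the \<open>Subst\<close> and bud steps
  removed (infinitely many steps remain, as those steps do not progress), and a trace \<open>C\<close> along
  the latter becomes the trace of the atoms \<open>C[\<theta>]\<close>.
\<close>

section \<open>Substitution\<close>

lemma sub_tm_comp: "sub_tm s (sub_tm s' t) = sub_tm (\<lambda>x. sub_tm s (s' x)) t"
  by (induction t) auto

lemma sub_comp: "sub s (sub s' \<phi>) = sub (\<lambda>x. sub_tm s (s' x)) \<phi>"
  by (induction \<phi>) (auto simp: sub_tm_comp)

lemma sub_tm_cong: "(\<And>x. x \<in> fv_tm t \<Longrightarrow> s x = s' x) \<Longrightarrow> sub_tm s t = sub_tm s' t"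
  by (induction t) auto

lemma sub_cong: "(\<And>x. x \<in> fv \<phi> \<Longrightarrow> s x = s' x) \<Longrightarrow> sub s \<phi> = sub s' \<phi>"
  by (induction \<phi>) (auto intro!: sub_tm_cong)

lemma sub_tm_Var [simp]: "sub_tm Var t = t"
  by (induction t) (auto simp: map_idI)

lemma sub_Var [simp]: "sub Var \<phi> = \<phi>"
  by (induction \<phi>) (auto simp: map_idI)

lemma fv_tm_sub_tm: "fv_tm (sub_tm s t) = (\<Union>x \<in> fv_tm t. fv_tm (s x))"
  by (induction t) auto

lemma fv_sub: "fv (sub s \<phi>) = (\<Union>x \<in> fv \<phi>. fv_tm (s x))"
  by (induction \<phi>) (auto simp: fv_tm_sub_tm)

lemma finite_fv_tm: "finite (fv_tm t)"
  by (induction t) auto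

lemma finite_fv: "finite (fv \<phi>)"
  by (induction \<phi>) (auto simp: finite_fv_tm)

lemma finite_fv_set: "finite \<Gamma> \<Longrightarrow> finite (fv_set \<Gamma>)"
  by (auto simp: fv_set_def finite_fv)

lemma fv_set_sub: "fv_set (sub s ` \<Gamma>) = (\<Union>x \<in> fv_set \<Gamma>. fv_tm (s x))"
  by (auto simp: fv_set_def fv_sub)

lemma finite_fv_prod: "finite (fv_prod r)"
  by (auto simp: fv_prod_def finite_fv)

lemma wf_tm_mono: "wf_tm \<Sigma> m t \<Longrightarrow> m \<le> n \<Longrightarrow> wf_tm \<Sigma> n t"
  by (induction t) (auto simp: list_all_iff)

lemma wf_tm_sub_tm:
  assumes "\<And>x. wf_tm \<Sigma> 0 (s x)"
  shows "wf_tm \<Sigma> n t \<Longrightarrow> wf_tm \<Sigma> n (sub_tm s t)"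
  by (induction t) (auto simp: list_all_iff intro: wf_tm_mono[OF assms])

lemma wf_fm_sub:
  assumes "\<And>x. wf_tm \<Sigma> 0 (s x)"
  shows "wf_fm \<Sigma> n \<phi> \<Longrightarrow> wf_fm \<Sigma> n (sub s \<phi>)"
  by (induction \<phi> arbitrary: n) (auto simp: list_all_iff intro: wf_tm_sub_tm[OF assms])

lemma opn_tm_wf: "wf_tm \<Sigma> n t \<Longrightarrow> n \<le> k \<Longrightarrow> opn_tm k u t = t"
  by (induction t) (auto simp: list_all_iff map_idI)

lemma sub_tm_opn_tm:
  assumes "\<And>x. wf_tm \<Sigma> 0 (s x)"
  shows "sub_tm s (opn_tm n t u) = opn_tm n (sub_tm s t) (sub_tm s u)"
  by (induction u) (auto simp: opn_tm_wf[OF assms])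

lemma sub_opn:
  assumes "\<And>x. wf_tm \<Sigma> 0 (s x)"
  shows "sub s (opn n t \<phi>) = opn n (sub_tm s t) (sub s \<phi>)"
  by (induction \<phi> arbitrary: n) (auto simp: sub_tm_opn_tm[OF assms])

lemma sub2_conv_sub:
  "x \<noteq> y \<Longrightarrow> sub2 x t y u \<phi> = sub (\<lambda>z. if z = x then t else if z = y then u else Var z) \<phi>"
  unfolding sub2_def by (rule sub_cong) (auto simp: sfun_def fmlookup_of_list)

text \<open>The substitution \<open>s'\<close> need only be right on the variables of
  \<open>r\<close>, as no others occur in its atoms. \<open>UR\<close> uses the composite of
  \<open>s\<close> and \<open>\<theta>\<close>; \<open>UL\<close> uses a new renaming that is
  matched only there.\<close>

lemma ord_atoms_sub:
  assumes "\<And>x. x \<in> fv_prod r \<Longrightarrow> sub_tm \<theta> (s x) = s' x"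
  shows "map (sub \<theta>) (ord_atoms r s) = ord_atoms r s'"
proof -
  have "sub \<theta> (sub s (Ord q ts)) = sub s' (Ord q ts)" if "(q, ts) \<in> set (ord_prems r)" for q ts
    unfolding sub_comp
    by (rule sub_cong, rule assms) (use that in \<open>force simp: fv_prod_def ord_atoms_def\<close>)
  then show ?thesis
    by (auto simp: ord_atoms_def simp del: sub.simps)
qed

lemma ind_atoms_sub:
  assumes "\<And>x. x \<in> fv_prod r \<Longrightarrow> sub_tm \<theta> (s x) = s' x"
  shows "map (sub \<theta>) (ind_atoms r s) = ind_atoms r s'"
proof -
  have "sub \<theta> (sub s (Ind q ts)) = sub s' (Ind q ts)" if "(q, ts) \<in> set (ind_prems r)" for q ts
    unfolding sub_comp
    by (rule sub_cong, rule assms) (use that in \<open>force simp: fv_prod_def ind_atoms_def\<close>)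
  then show ?thesis
    by (auto simp: ind_atoms_def simp del: sub.simps)
qed

lemma head_atom_sub:
  assumes "\<And>x. x \<in> fv_prod r \<Longrightarrow> sub_tm \<theta> (s x) = s' x"
  shows "sub \<theta> (head_atom r s) = head_atom r s'"
  unfolding head_atom_def sub_comp
  by (rule sub_cong, rule assms) (auto simp: fv_prod_def head_atom_def)

lemma unfolding_formulas_sub:
  fixes r :: "('f, 'q, 'p) production"
  assumes "\<And>x. x \<in> fv_prod r \<Longrightarrow> sub_tm \<theta> (s x) = s' x"
  shows "sub \<theta> ` unfolding_formulas us r s = unfolding_formulas (map (sub_tm \<theta>) us) r s'"
proof -
  \<comment> \<open>Injectivity of \<open>Ind\<close> extracts the equality of the argument lists
    from that of the heads.\<close>
  have args: "map (sub_tm \<theta>) (map (sub_tm s) (head_args r)) = map (sub_tm s') (head_args r)"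
    using head_atom_sub[OF assms] by (simp add: head_atom_def)
  have "map (sub \<theta>) (map2 Eq us ts :: ('f, 'q, 'p) fm list)
      = map2 Eq (map (sub_tm \<theta>) us) (map (sub_tm \<theta>) ts)" for ts
    by (simp add: zip_map_map case_prod_beta)
  note this[of "map (sub_tm s) (head_args r)", unfolded args]
  moreover have "map (sub \<theta>) (ord_atoms r s) = ord_atoms r s'"
    by (rule ord_atoms_sub) (rule assms)
  moreover have "map (sub \<theta>) (ind_atoms r s) = ind_atoms r s'"
    by (rule ind_atoms_sub) (rule assms)
  ultimately show ?thesis
    unfolding unfolding_formulas_def image_Un by (simp only: flip: set_map)
qed

section \<open>Instances of sequents and of whole inferences\<close>

definition sub_seq :: "(var \<Rightarrow> 'f tm) \<Rightarrow> ('f, 'q, 'p) sequent \<Rightarrow> ('f, 'q, 'p) sequent" where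
  "sub_seq \<theta> S = (sub \<theta> ` fst S, sub \<theta> ` snd S)"

definition fv_seq :: "('f, 'q, 'p) sequent \<Rightarrow> var set" where
  "fv_seq S = fv_set (fst S \<union> snd S)"

lemma wf_sequent_sub_seq:
  "(\<And>x. wf_tm \<Sigma> 0 (\<theta> x)) \<Longrightarrow> wf_sequent \<Sigma> S \<Longrightarrow> wf_sequent \<Sigma> (sub_seq \<theta> S)"
  by (auto simp: wf_sequent_def sub_seq_def intro: wf_fm_sub)

lemma sub_seq_cong: "(\<And>x. x \<in> fv_seq S \<Longrightarrow> \<theta> x = \<eta> x) \<Longrightarrow> sub_seq \<theta> S = sub_seq \<eta> S"
  by (force simp: sub_seq_def fv_seq_def fv_set_def intro!: image_cong sub_cong)

text \<open>Each premise has its own substitution in \<open>\<theta>s\<close>, since eigenvariables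
  are renamed premise by premise. Traces are transported only for \<open>C\<close> in the antecedent
  of the conclusion: for most rules \<open>trace_step\<close> does not check membership, and on a
  formula containing an eigenvariable \<open>\<theta>\<close> and the substitution of the premise
  may differ.\<close>

definition inference_instance ::
    "('f, 'q, 'p) signature \<Rightarrow> ('f, 'q, 'p) production set \<Rightarrow> (var \<Rightarrow> 'f tm) \<Rightarrow>
     ('f, 'q, 'p) inference \<Rightarrow> ('f, 'q, 'p) inference \<Rightarrow> (var \<Rightarrow> 'f tm) list \<Rightarrow> bool" where
  "inference_instance \<Sigma> \<Phi> \<theta> i j \<theta>s \<longleftrightarrow>
     wf_inference \<Sigma> \<Phi> j \<and> rule_of j = rule_of i \<and> concl j = sub_seq \<theta> (concl i) \<and>
     length \<theta>s = length (prems i) \<and> prems j = map2 sub_seq \<theta>s (prems i) \<and>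
     (\<forall>k < length \<theta>s. \<forall>C \<in> fst (concl i). \<forall>C'.
       (trace_step i k C C' \<longrightarrow> trace_step j k (sub \<theta> C) (sub (\<theta>s ! k) C')) \<and>
       (progress_step i k C C' \<longrightarrow> progress_step j k (sub \<theta> C) (sub (\<theta>s ! k) C')))"

text \<open>The sequents of \<open>j\<close> are instances of those of \<open>i\<close> under
  substitutions by well-formed terms, so their well-formedness comes for free.\<close>

lemma inference_instanceI:
  assumes "wf_inference \<Sigma> \<Phi> i" "\<And>x. wf_tm \<Sigma> 0 (\<theta> x)"
    and "\<And>\<eta> x. \<eta> \<in> set \<theta>s \<Longrightarrow> wf_tm \<Sigma> 0 (\<eta> x)"
    and "side_cond \<Sigma> \<Phi> j" "rule_of j = rule_of i" "concl j = sub_seq \<theta> (concl i)"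
    and "length \<theta>s = length (prems i)" "prems j = map2 sub_seq \<theta>s (prems i)"
    and "\<And>k C C'. \<lbrakk>k < length \<theta>s; C \<in> fst (concl i); trace_step i k C C'\<rbrakk>
      \<Longrightarrow> trace_step j k (sub \<theta> C) (sub (\<theta>s ! k) C')"
    and "\<And>k C C'. \<lbrakk>k < length \<theta>s; C \<in> fst (concl i); progress_step i k C C'\<rbrakk>
      \<Longrightarrow> progress_step j k (sub \<theta> C) (sub (\<theta>s ! k) C')"
  shows "inference_instance \<Sigma> \<Phi> \<theta> i j \<theta>s"
proof -
  have "wf_sequent \<Sigma> S" if "S \<in> set (prems j)" for S
    using that assms(1,3,8) 
    by (auto simp: wf_inference_def intro!: wf_sequent_sub_seq elim!: in_set_zipE)
  moreover have "wf_sequent \<Sigma> (concl j)"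
    using assms(1,2,6) by (auto simp: wf_inference_def intro!: wf_sequent_sub_seq)
  ultimately show ?thesis
    using assms by (simp add: inference_instance_def wf_inference_def)
qed

section \<open>Substitution instances of inferences\<close>

lemma map2_replicate: "length xs = n \<Longrightarrow> map2 f (replicate n c) xs = map (f c) xs"
  by (induction xs arbitrary: n) auto

text \<open>Serves the rules that have no eigenvariable and whose traces keep the formula unchanged;
  the same \<open>\<theta>\<close> then works in all premises.\<close>

lemma inference_instance_uniform:
  assumes "wf_inference \<Sigma> \<Phi> i" "\<And>x. wf_tm \<Sigma> 0 (\<theta> x)"
    and "side_cond \<Sigma> \<Phi> j" "rule_of j = rule_of i" "concl j = sub_seq \<theta> (concl i)"
    and "prems j = map (sub_seq \<theta>) (prems i)"
    and "\<And>k C C'. trace_step i k C C' \<Longrightarrow> C' = C"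
    and "\<And>k C. trace_step j k C C"
    and "\<And>k C C'. \<not> progress_step i k C C'"
  shows "inference_instance \<Sigma> \<Phi> \<theta> i j (replicate (length (prems i)) \<theta>)"
proof (rule inference_instanceI[OF assms(1,2)])
  show "trace_step j k (sub \<theta> C) (sub (replicate (length (prems i)) \<theta> ! k) C')"
    if "k < length (replicate (length (prems i)) \<theta>)" "trace_step i k C C'" for k C C'
    using that assms(7)[OF that(2)] assms(8) by simp
qed (use assms in \<open>auto simp: map2_replicate\<close>)

lemma obtain_fresh_renaming:
  fixes V :: "var set"
  assumes "finite V" "finite X" "finite Y" "card X + card Y < card V"
  obtains g :: "var \<Rightarrow> var" where "inj_on g Y" "g ` Y \<subseteq> V - X"
proof -
  have "card Y \<le> card (V - X)"
    using diff_card_le_card_Diff[OF assms(2), of V] assms(4) by linarith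
  then show thesis
    using card_le_inj[of Y "V - X"] assms that by auto
qed

text \<open>Each term contributes at most one variable. This keeps every instance of a sequent small
  enough for one fixed pool: the bound does not grow as substitutions accumulate.\<close>

lemma card_fv_sub_le:
  assumes "finite X" "\<And>x. card (fv_tm (\<theta> x)) \<le> 1"
  shows "card (\<Union>x \<in> X. fv_tm (\<theta> x)) \<le> card X"
  by (rule order_trans[OF card_UN_le[OF assms(1)]])
    (use sum_bounded_above[of X "\<lambda>x. card (fv_tm (\<theta> x))" 1] assms in auto)

text \<open>In each premise \<open>\<theta>\<close> is overridden on the eigenvariables, which are
  sent to pool variables fresh for the instance of the conclusion. The context and the unfolded atom
  contain no eigenvariable, so there the new substitution still acts as
  \<open>\<theta>\<close>.\<close>

lemma inference_instance_UL:
  fixes \<theta> :: "var \<Rightarrow> 'f tm" and \<Phi> :: "('f, 'q, 'p) production set"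
  assumes wf: "wf_inference \<Sigma> \<Phi> (UL \<Gamma> \<Delta> p us rs)" and \<theta>: "\<And>x. wf_tm \<Sigma> 0 (\<theta> x)"
    and A: "range \<theta> \<subseteq> A" "Var ` V \<subseteq> A"
    and fresh: "\<And>r. r \<in> \<Phi> \<Longrightarrow> \<exists>g. inj_on g (fv_prod r) \<and>
      g ` fv_prod r \<subseteq> V - fv_seq (sub_seq \<theta> (insert (Ind p us) \<Gamma>, \<Delta>))"
  shows "\<exists>j \<theta>s. inference_instance \<Sigma> \<Phi> \<theta> (UL \<Gamma> \<Delta> p us rs) j \<theta>s \<and> (\<forall>\<eta> \<in> set \<theta>s. range \<eta> \<subseteq> A)"
proof -
  obtain g where g: "\<And>r. r \<in> \<Phi> \<Longrightarrow> inj_on (g r) (fv_prod r)"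
    "\<And>r. r \<in> \<Phi> \<Longrightarrow> g r ` fv_prod r \<subseteq> V - fv_seq (sub_seq \<theta> (insert (Ind p us) \<Gamma>, \<Delta>))"
    using fresh by metis
  \<comment> \<open>As \<open>\<rho>\<close> is injective on \<open>fv_prod r\<close>,
    \<open>inv_into\<close> recovers the production variable behind each eigenvariable, and
    \<open>g r\<close> gives it a new name.\<close>
  define ext where "ext = (\<lambda>(r, \<rho>) z. if z \<in> \<rho> ` fv_prod r
    then Var (g r (inv_into (fv_prod r) \<rho> z)) else \<theta> z)"
  have side: "set (map fst rs) = {r \<in> \<Phi>. head_pred r = p}" "distinct (map fst rs)"
    and ren: "\<forall>(r, \<rho>) \<in> set rs. inj_on \<rho> (fv_prod r) \<and>
      \<rho> ` fv_prod r \<inter> fv_set (insert (Ind p us) (\<Gamma> \<union> \<Delta>)) = {}"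
    using wf by (simp_all add: wf_inference_def)
  have rs\<Phi>: "r \<in> \<Phi>" if "(r, \<rho>) \<in> set rs" for r \<rho>
    using side(1) that by force
  have ext_new: "ext (r, \<rho>) (\<rho> x) = Var (g r x)" if "(r, \<rho>) \<in> set rs" "x \<in> fv_prod r" for r \<rho> x
    using ren that by (auto simp: ext_def)
  have ext_old: "ext (r, \<rho>) x = \<theta> x"
    if "(r, \<rho>) \<in> set rs" "x \<in> fv_set (insert (Ind p us) (\<Gamma> \<union> \<Delta>))" for r \<rho> x
    using ren that by (fastforce simp: ext_def)
  have ext_A: "range (ext (r, \<rho>)) \<subseteq> A" if "(r, \<rho>) \<in> set rs" for r \<rho>
  proof -
    have "g r x \<in> V" if "x \<in> fv_prod r" for x
      using g(2)[OF rs\<Phi>[OF \<open>(r, \<rho>) \<in> set rs\<close>]] that by auto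
    then show ?thesis
      using A by (auto simp: ext_def inv_into_into)
  qed
  have old: "sub (ext (r, \<rho>)) \<phi> = sub \<theta> \<phi>"
    if "(r, \<rho>) \<in> set rs" "\<phi> \<in> insert (Ind p us) (\<Gamma> \<union> \<Delta>)" for r \<rho> \<phi>
    by (rule sub_cong, rule ext_old[OF that(1)]) (use that(2) in \<open>auto simp: fv_set_def\<close>)
  have us: "map (sub_tm (ext (r, \<rho>))) us = map (sub_tm \<theta>) us" if "(r, \<rho>) \<in> set rs" for r \<rho>
    using old[OF that, of "Ind p us"] by simp
  let ?rs = "map (\<lambda>(r, \<rho>). (r, g r)) rs"
  let ?j = "UL (sub \<theta> ` \<Gamma>) (sub \<theta> ` \<Delta>) p (map (sub_tm \<theta>) us) ?rs"
  have "inference_instance \<Sigma> \<Phi> \<theta> (UL \<Gamma> \<Delta> p us rs) ?j (map ext rs)"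
  proof (rule inference_instanceI[OF wf \<theta>])
    show "wf_tm \<Sigma> 0 (\<eta> x)" if "\<eta> \<in> set (map ext rs)" for \<eta> x
      using that \<theta> by (auto simp: ext_def)
    have "map fst ?rs = map fst rs"
      by (auto simp: case_prod_beta)
    moreover have "insert (Ind p (map (sub_tm \<theta>) us)) (sub \<theta> ` \<Gamma> \<union> sub \<theta> ` \<Delta>)
        = fst (sub_seq \<theta> (insert (Ind p us) \<Gamma>, \<Delta>)) \<union> snd (sub_seq \<theta> (insert (Ind p us) \<Gamma>, \<Delta>))"
      by (auto simp: sub_seq_def)
    ultimately have "g r x \<notin> fv_set (insert (Ind p (map (sub_tm \<theta>) us)) (sub \<theta> ` \<Gamma> \<union> sub \<theta> ` \<Delta>))"
      if "(r, \<rho>) \<in> set rs" "x \<in> fv_prod r" for r \<rho> x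
      using g(2)[OF rs\<Phi>[OF that(1)]] that(2) unfolding fv_seq_def by auto
    with \<open>map fst ?rs = map fst rs\<close> side g(1)[OF rs\<Phi>] show "side_cond \<Sigma> \<Phi> ?j"
      by (auto simp del: map_map)
    have "sub (ext (r, \<rho>)) ` unfolding_formulas us r (Var \<circ> \<rho>)
        = unfolding_formulas (map (sub_tm \<theta>) us) r (Var \<circ> g r)" if "(r, \<rho>) \<in> set rs" for r \<rho>
      using unfolding_formulas_sub[of r "ext (r, \<rho>)" "Var \<circ> \<rho>" "Var \<circ> g r" us] ext_new[OF that]
        us[OF that] by simp
    moreover have "sub (ext (r, \<rho>)) ` \<Gamma> = sub \<theta> ` \<Gamma>" "sub (ext (r, \<rho>)) ` \<Delta> = sub \<theta> ` \<Delta>"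
      if "(r, \<rho>) \<in> set rs" for r \<rho>
      using old[OF that] by (auto intro!: image_cong)
    ultimately have "sub_seq (ext (r, \<rho>)) (\<Gamma> \<union> unfolding_formulas us r (Var \<circ> \<rho>), \<Delta>)
        = (sub \<theta> ` \<Gamma> \<union> unfolding_formulas (map (sub_tm \<theta>) us) r (Var \<circ> g r), sub \<theta> ` \<Delta>)"
      if "(r, \<rho>) \<in> set rs" for r \<rho>
      using that by (simp add: sub_seq_def image_Un)
    then show "prems ?j = map2 sub_seq (map ext rs) (prems (UL \<Gamma> \<Delta> p us rs))"
      by (auto simp: zip_map_map zip_same_conv_map)
    have prog: "progress_step ?j k (sub \<theta> C) (sub (map ext rs ! k) C')"
      if k: "k < length (map ext rs)" and "progress_step (UL \<Gamma> \<Delta> p us rs) k C C'" for k C C'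
    proof -
      obtain r \<rho> where r: "rs ! k = (r, \<rho>)" by force
      then have in_rs: "(r, \<rho>) \<in> set rs"
        using k by (metis length_map nth_mem)
      have "map (sub (ext (r, \<rho>))) (ind_atoms r (Var \<circ> \<rho>)) = ind_atoms r (Var \<circ> g r)"
        by (rule ind_atoms_sub) (use ext_new[OF in_rs] in auto)
      moreover have C: "C = Ind p us" "C' \<in> set (ind_atoms r (Var \<circ> \<rho>))"
        using that(2) r by auto
      ultimately have "sub (ext (r, \<rho>)) C' \<in> set (ind_atoms r (Var \<circ> g r))"
        by (metis image_eqI set_map)
      then show ?thesis
        using k r C by simp
    qed
    then show "progress_step ?j k (sub \<theta> C) (sub (map ext rs ! k) C')"
      if "k < length (map ext rs)" "progress_step (UL \<Gamma> \<Delta> p us rs) k C C'" for k C C'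
      using that by blast
    show "trace_step ?j k (sub \<theta> C) (sub (map ext rs ! k) C')"
      if k: "k < length (map ext rs)" and ts: "trace_step (UL \<Gamma> \<Delta> p us rs) k C C'" for k C C'
    proof (cases "progress_step (UL \<Gamma> \<Delta> p us rs) k C C'")
      case True
      then show ?thesis using prog[OF k] by simp
    next
      \<comment> \<open>An occurrence that is not unfolded is a formula of the context, where the
        substitution of the premise agrees with \<open>\<theta>\<close>.\<close>
      case False
      then have "C \<in> \<Gamma>" "C' = C" using ts by auto
      moreover have "(fst (rs ! k), snd (rs ! k)) \<in> set rs" using k by simp
      ultimately have "sub (map ext rs ! k) C' = sub \<theta> C"
        using old[of "fst (rs ! k)" "snd (rs ! k)" C] k by simp
      then show ?thesis using \<open>C \<in> \<Gamma>\<close> by simp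
    qed
  qed (auto simp: sub_seq_def)
  moreover have "\<forall>\<eta> \<in> set (map ext rs). range \<eta> \<subseteq> A"
    using ext_A by auto
  ultimately show ?thesis by blast
qed

text \<open>
  The new names for \<open>x\<close> and \<open>y\<close> need not be taken from a finite pool, as they do not occur in the
  premise.
\<close>

lemma inference_instance_EqL:
  assumes wf: "wf_inference \<Sigma> \<Phi> (EqL \<Gamma> \<Delta> x y t u)" and \<theta>: "\<And>x. wf_tm \<Sigma> 0 (\<theta> x)"
  shows "\<exists>j. inference_instance \<Sigma> \<Phi> \<theta> (EqL \<Gamma> \<Delta> x y t u) j [\<theta>]"
proof -
  have xy: "x \<noteq> y" and wfS: "wf_sequent \<Sigma> (\<Gamma>, \<Delta>)"
    using wf by (auto simp: wf_inference_def)
  define X where "X = (\<Union>z \<in> fv_seq (\<Gamma>, \<Delta>). fv_tm (\<theta> z))"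
  have "finite X"
    using wfS by (auto simp: X_def fv_seq_def wf_sequent_def finite_fv_set finite_fv_tm)
  then obtain x' where x': "x' \<notin> X" using ex_new_if_finite[of X] by auto
  obtain y' where y': "y' \<notin> insert x' X"
    using \<open>finite X\<close> ex_new_if_finite[of "insert x' X"] by auto
  let ?\<eta> = "\<theta>(x := Var x', y := Var y')"
  have \<eta>: "wf_tm \<Sigma> 0 (?\<eta> z)" for z
    using \<theta> by simp
  \<comment> \<open>Both sides are single substitutions applied to \<open>\<phi>\<close>. At
    \<open>x\<close> and \<open>y\<close> they agree by the choice of \<open>?\<eta>\<close>; at any
    other \<open>z\<close> the term \<open>\<theta> z\<close> contains neither \<open>x'\<close> nor
    \<open>y'\<close>. The conclusion uses this with \<open>t\<close> and \<open>u\<close>, the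
    premise with the two exchanged.\<close>
  have comm: "sub2 x' (sub_tm \<theta> s) y' (sub_tm \<theta> s') (sub ?\<eta> \<phi>) = sub \<theta> (sub2 x s y s' \<phi>)"
    if "\<phi> \<in> \<Gamma> \<union> \<Delta>" for \<phi> s s'
  proof -
    have "sub_tm (\<lambda>z. if z = x' then sub_tm \<theta> s else if z = y' then sub_tm \<theta> s' else Var z) (?\<eta> z)
        = sub_tm \<theta> (if z = x then s else if z = y then s' else Var z)" if "z \<in> fv \<phi>" for z
    proof -
      have "fv_tm (\<theta> z) \<subseteq> X"
        using that \<open>\<phi> \<in> \<Gamma> \<union> \<Delta>\<close> by (auto simp: X_def fv_seq_def fv_set_def)
      then have "sub_tm (\<lambda>z. if z = x' then sub_tm \<theta> s else if z = y' then sub_tm \<theta> s' else Var z) (\<theta> z)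
          = sub_tm Var (\<theta> z)"
        using x' y' by (intro sub_tm_cong) auto
      then show ?thesis using xy y' by auto
    qed
    then show ?thesis
      using xy y' by (auto simp: sub2_conv_sub sub_comp intro: sub_cong)
  qed
  let ?j = "EqL (sub ?\<eta> ` \<Gamma>) (sub ?\<eta> ` \<Delta>) x' y' (sub_tm \<theta> t) (sub_tm \<theta> u)"
  have "inference_instance \<Sigma> \<Phi> \<theta> (EqL \<Gamma> \<Delta> x y t u) ?j [\<theta>]"
  proof (rule inference_instanceI[OF wf \<theta>])
    show "side_cond \<Sigma> \<Phi> ?j"
      using y' wf_sequent_sub_seq[of \<Sigma> ?\<eta>, OF \<eta> wfS] by (simp add: sub_seq_def)
    show "concl ?j = sub_seq \<theta> (concl (EqL \<Gamma> \<Delta> x y t u))"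
      "prems ?j = map2 sub_seq [\<theta>] (prems (EqL \<Gamma> \<Delta> x y t u))"
      using comm by (auto simp: sub_seq_def image_image intro!: image_cong)
    show "trace_step ?j k (sub \<theta> C) (sub ([\<theta>] ! k) C')"
      if "k < length [\<theta>]" "trace_step (EqL \<Gamma> \<Delta> x y t u) k C C'" for k C C'
      using that comm by force
  qed (use \<theta> in auto)
  then show ?thesis by blast
qed

text \<open>The eigenvariable does not occur in the conclusion, so redirecting it to
  \<open>y'\<close> affects nothing but the instantiated body. The two rules are symmetric enough to
  share the argument.\<close>

lemma inference_instance_eigenvariable:
  fixes \<theta> :: "var \<Rightarrow> 'f tm"
  assumes wf: "wf_inference \<Sigma> \<Phi> i" and \<theta>: "\<And>x. wf_tm \<Sigma> 0 (\<theta> x)"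
    and y': "y' \<notin> fv_seq (sub_seq \<theta> (concl i))"
    and i: "i = AllR \<Gamma> \<Delta> \<phi> y \<or> i = ExL \<Gamma> \<Delta> \<phi> y"
  shows "\<exists>j. inference_instance \<Sigma> \<Phi> \<theta> i j [\<theta>(y := Var y')]"
proof -
  let ?\<eta> = "\<theta>(y := Var y')"
  have \<eta>: "wf_tm \<Sigma> 0 (?\<eta> x)" for x
    using \<theta> by simp
  have "y \<notin> fv_set (insert (Forall \<phi>) (\<Gamma> \<union> \<Delta>))" "y \<notin> fv_set (insert (Exists \<phi>) (\<Gamma> \<union> \<Delta>))"
    using wf i by (auto simp: wf_inference_def fv_set_def)
  then have old: "sub ?\<eta> \<psi> = sub \<theta> \<psi>"
    if "\<psi> \<in> insert \<phi> (insert (Exists \<phi>) (insert (Forall \<phi>) (\<Gamma> \<union> \<Delta>)))" for \<psi>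
    using that by (intro sub_cong) (auto simp: fv_set_def)
  have im: "sub ?\<eta> ` \<Gamma> = sub \<theta> ` \<Gamma>" "sub ?\<eta> ` \<Delta> = sub \<theta> ` \<Delta>"
    using old by (auto intro!: image_cong)
  \<comment> \<open>\<open>sub_opn\<close> distributes the substitution over the witness, where it
    yields \<open>y'\<close>, and the body, which lacks \<open>y\<close>.\<close>
  have body: "sub ?\<eta> (opn 0 (Var y) \<phi>) = opn 0 (Var y') (sub \<theta> \<phi>)"
    using old[of \<phi>] by (simp add: sub_opn[of \<Sigma> ?\<eta>, OF \<eta>] fun_upd_same del: fun_upd_apply)
  \<comment> \<open>The default branch is reached only for \<open>ExL\<close>.\<close>
  let ?j = "case i of AllR _ _ _ _ \<Rightarrow> AllR (sub \<theta> ` \<Gamma>) (sub \<theta> ` \<Delta>) (sub \<theta> \<phi>) y'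
    | _ \<Rightarrow> ExL (sub \<theta> ` \<Gamma>) (sub \<theta> ` \<Delta>) (sub \<theta> \<phi>) y'"
  have "inference_instance \<Sigma> \<Phi> \<theta> i ?j [?\<eta>]"
  proof (rule inference_instanceI[OF wf \<theta>])
    show "side_cond \<Sigma> \<Phi> ?j"
      using i y' by (auto simp: fv_seq_def sub_seq_def fv_set_def)
    show "concl ?j = sub_seq \<theta> (concl i)" "prems ?j = map2 sub_seq [?\<eta>] (prems i)"
      using i by (auto simp: sub_seq_def im body)
    show "trace_step ?j k (sub \<theta> C) (sub ([?\<eta>] ! k) C')"
      if "k < length [?\<eta>]" "C \<in> fst (concl i)" "trace_step i k C C'" for k C C'
      using that i old[of C] by auto
  qed (use i \<eta> in auto)
  then show ?thesis by blast
qed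

text \<open>Rule by rule, the substitution is pushed from the conclusion to the premises without
  leaving \<open>A\<close>. The cardinality assumptions ensure that \<open>V\<close> still has a
  fresh variable for \<open>AllR\<close> and \<open>ExL\<close>, and enough of them for each
  production unfolded by \<open>UL\<close>.\<close>

lemma ex_inference_instance:
  fixes i :: "('f, 'q, 'p) inference" and \<theta> :: "var \<Rightarrow> 'f tm"
  assumes wf: "wf_inference \<Sigma> \<Phi> i" and not_Subst: "rule_of i \<noteq> R_Subst"
    and \<theta>: "\<And>x. wf_tm \<Sigma> 0 (\<theta> x)" "\<And>x. card (fv_tm (\<theta> x)) \<le> 1"
    and A: "range \<theta> \<subseteq> A" "Var ` V \<subseteq> A"
    and V: "finite V" "card (fv_seq (concl i)) < card V"
      "\<And>r. r \<in> \<Phi> \<Longrightarrow> card (fv_seq (concl i)) + card (fv_prod r) < card V"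
  shows "\<exists>j \<theta>s. inference_instance \<Sigma> \<Phi> \<theta> i j \<theta>s \<and> (\<forall>\<eta> \<in> set \<theta>s. range \<eta> \<subseteq> A)"
proof -
  let ?X = "fv_seq (sub_seq \<theta> (concl i))"
  have fin: "finite (fv_seq (concl i))"
    using wf by (auto simp: wf_inference_def wf_sequent_def fv_seq_def finite_fv_set)
  have X: "?X = (\<Union>x \<in> fv_seq (concl i). fv_tm (\<theta> x))"
    by (simp add: fv_seq_def sub_seq_def fv_set_sub flip: image_Un)
  have finX: "finite ?X"
    using fin by (simp add: X finite_fv_tm)
  have cardX: "card ?X \<le> card (fv_seq (concl i))"
    unfolding X by (rule card_fv_sub_le[OF fin \<theta>(2)])
  have "\<not> V \<subseteq> ?X"
    using card_mono[OF finX, of V] cardX V(2) by linarith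
  then obtain y' where y': "y' \<in> V" "y' \<notin> ?X" by blast
  \<comment> \<open>All premises use \<open>\<theta>\<close> itself, so the bound on the ranges is
    immediate. This covers \<open>EqL\<close> too, whose renaming does not show in the substitution
    of the premise.\<close>
  have uniform: ?thesis
    if "\<exists>j. inference_instance \<Sigma> \<Phi> \<theta> i j (replicate (length (prems i)) \<theta>)"
    using that A(1) by (metis in_set_replicate)
  note unif = uniform[OF exI, OF inference_instance_uniform[OF wf \<theta>(1)]]
  have side: "side_cond \<Sigma> \<Phi> i" using wf by (simp add: wf_inference_def)
  show ?thesis
  proof (cases i)
    case (Axiom \<Gamma> \<Delta>)
    show ?thesis
      by (rule unif[of "Axiom (sub \<theta> ` \<Gamma>) (sub \<theta> ` \<Delta>)"])
        (use Axiom side in \<open>auto simp: sub_seq_def\<close>)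
  next
    case (EqR \<Gamma> \<Delta> t)
    show ?thesis
      by (rule unif[of "EqR (sub \<theta> ` \<Gamma>) (sub \<theta> ` \<Delta>) (sub_tm \<theta> t)"])
        (use EqR side in \<open>auto simp: sub_seq_def\<close>)
  next
    case (Wk \<Gamma> \<Delta> \<Gamma>' \<Delta>')
    show ?thesis
      by (rule unif[of "Wk (sub \<theta> ` \<Gamma>) (sub \<theta> ` \<Delta>) (sub \<theta> ` \<Gamma>') (sub \<theta> ` \<Delta>')"])
        (use Wk side in \<open>auto simp: sub_seq_def\<close>)
  next
    case (Cut \<Gamma> \<Delta> \<phi>)
    show ?thesis
      by (rule unif[of "Cut (sub \<theta> ` \<Gamma>) (sub \<theta> ` \<Delta>) (sub \<theta> \<phi>)"])
        (use Cut side in \<open>auto simp: sub_seq_def\<close>)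
  next
    case (Subst \<Gamma> \<Delta> \<sigma>)
    then show ?thesis using not_Subst by simp
  next
    case (NegL \<Gamma> \<Delta> \<phi>)
    show ?thesis
      by (rule unif[of "NegL (sub \<theta> ` \<Gamma>) (sub \<theta> ` \<Delta>) (sub \<theta> \<phi>)"])
        (use NegL side in \<open>auto simp: sub_seq_def\<close>)
  next
    case (NegR \<Gamma> \<Delta> \<phi>)
    show ?thesis
      by (rule unif[of "NegR (sub \<theta> ` \<Gamma>) (sub \<theta> ` \<Delta>) (sub \<theta> \<phi>)"])
        (use NegR side in \<open>auto simp: sub_seq_def\<close>)
  next
    case (OrL \<Gamma> \<Delta> \<phi> \<psi>)
    show ?thesis
      by (rule unif[of "OrL (sub \<theta> ` \<Gamma>) (sub \<theta> ` \<Delta>) (sub \<theta> \<phi>) (sub \<theta> \<psi>)"])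
        (use OrL side in \<open>auto simp: sub_seq_def\<close>)
  next
    case (OrR \<Gamma> \<Delta> \<phi> \<psi>)
    show ?thesis
      by (rule unif[of "OrR (sub \<theta> ` \<Gamma>) (sub \<theta> ` \<Delta>) (sub \<theta> \<phi>) (sub \<theta> \<psi>)"])
        (use OrR side in \<open>auto simp: sub_seq_def\<close>)
  next
    case (AndL \<Gamma> \<Delta> \<phi> \<psi>)
    show ?thesis
      by (rule unif[of "AndL (sub \<theta> ` \<Gamma>) (sub \<theta> ` \<Delta>) (sub \<theta> \<phi>) (sub \<theta> \<psi>)"])
        (use AndL side in \<open>auto simp: sub_seq_def\<close>)
  next
    case (AndR \<Gamma> \<Delta> \<phi> \<psi>)
    show ?thesis
      by (rule unif[of "AndR (sub \<theta> ` \<Gamma>) (sub \<theta> ` \<Delta>) (sub \<theta> \<phi>) (sub \<theta> \<psi>)"])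
        (use AndR side in \<open>auto simp: sub_seq_def\<close>)
  next
    case (ImpL \<Gamma> \<Delta> \<phi> \<psi>)
    show ?thesis
      by (rule unif[of "ImpL (sub \<theta> ` \<Gamma>) (sub \<theta> ` \<Delta>) (sub \<theta> \<phi>) (sub \<theta> \<psi>)"])
        (use ImpL side in \<open>auto simp: sub_seq_def\<close>)
  next
    case (ImpR \<Gamma> \<Delta> \<phi> \<psi>)
    show ?thesis
      by (rule unif[of "ImpR (sub \<theta> ` \<Gamma>) (sub \<theta> ` \<Delta>) (sub \<theta> \<phi>) (sub \<theta> \<psi>)"])
        (use ImpR side in \<open>auto simp: sub_seq_def\<close>)
  next
    case (AllL \<Gamma> \<Delta> \<phi> t)
    show ?thesis
      by (rule unif[of "AllL (sub \<theta> ` \<Gamma>) (sub \<theta> ` \<Delta>) (sub \<theta> \<phi>) (sub_tm \<theta> t)"])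
        (use AllL side \<theta> in \<open>auto simp: sub_seq_def sub_opn[OF \<theta>(1)] intro: wf_tm_sub_tm\<close>)
  next
    case (ExR \<Gamma> \<Delta> \<phi> t)
    show ?thesis
      by (rule unif[of "ExR (sub \<theta> ` \<Gamma>) (sub \<theta> ` \<Delta>) (sub \<theta> \<phi>) (sub_tm \<theta> t)"])
        (use ExR side \<theta> in \<open>auto simp: sub_seq_def sub_opn[OF \<theta>(1)] intro: wf_tm_sub_tm\<close>)
  next
    case (UR \<Gamma> \<Delta> r s)
    have "concl i = (\<Gamma>, insert (head_atom r s) \<Delta>)" using UR by simp
    moreover have "sub \<theta> (head_atom r s) = head_atom r (\<lambda>x. sub_tm \<theta> (s x))"
      by (rule head_atom_sub) simp
    moreover have "map (sub \<theta>) (ord_atoms r s) = ord_atoms r (\<lambda>x. sub_tm \<theta> (s x))"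
      by (rule ord_atoms_sub) simp
    moreover have "map (sub \<theta>) (ind_atoms r s) = ind_atoms r (\<lambda>x. sub_tm \<theta> (s x))"
      by (rule ind_atoms_sub) simp
    ultimately show ?thesis
      by (intro unif[of "UR (sub \<theta> ` \<Gamma>) (sub \<theta> ` \<Delta>) r (\<lambda>x. sub_tm \<theta> (s x))"])
        (use UR side \<theta> in \<open>auto simp: sub_seq_def intro: wf_tm_sub_tm
          simp flip: \<open>map (sub \<theta>) (ord_atoms r s) = _\<close> \<open>map (sub \<theta>) (ind_atoms r s) = _\<close>\<close>)
  next
    case (EqL \<Gamma> \<Delta> x y t u)
    show ?thesis
      by (rule uniform) (use inference_instance_EqL[OF wf[unfolded EqL] \<theta>(1)] EqL in simp)
  next
    case (AllR \<Gamma> \<Delta> \<phi> y)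
    then obtain j where "inference_instance \<Sigma> \<Phi> \<theta> i j [\<theta>(y := Var y')]"
      using inference_instance_eigenvariable[OF wf \<theta>(1) y'(2)] by blast
    moreover have "range (\<theta>(y := Var y')) \<subseteq> A" using A y'(1) by auto
    ultimately show ?thesis
      by (intro exI[of _ j] exI[of _ "[\<theta>(y := Var y')]"]) simp
  next
    case (ExL \<Gamma> \<Delta> \<phi> y)
    then obtain j where "inference_instance \<Sigma> \<Phi> \<theta> i j [\<theta>(y := Var y')]"
      using inference_instance_eigenvariable[OF wf \<theta>(1) y'(2)] by blast
    moreover have "range (\<theta>(y := Var y')) \<subseteq> A" using A y'(1) by auto
    ultimately show ?thesis
      by (intro exI[of _ j] exI[of _ "[\<theta>(y := Var y')]"]) simp
  next
    case (UL \<Gamma> \<Delta> p us rs)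
    have "\<exists>g. inj_on g (fv_prod r) \<and> g ` fv_prod r \<subseteq> V - ?X" if "r \<in> \<Phi>" for r
    proof -
      have "card ?X + card (fv_prod r) < card V"
        using cardX V(3)[OF that] by linarith
      from obtain_fresh_renaming[OF V(1) finX finite_fv_prod this] show ?thesis by metis
    qed
    then show ?thesis
      using inference_instance_UL[OF wf[unfolded UL] \<theta>(1) A] UL by simp
  qed
qed

section \<open>Unfolding finite graphs of inferences\<close>

text \<open>
  \<open>h\<close> maps the states on the branch below to their addresses and \<open>a\<close> is the current address. The
  number \<open>n\<close> is fuel; case \<open>0\<close> is not reached when \<open>n\<close> exceeds the number of unvisited states.
\<close>

primrec unfold_tree ::
    "('s \<Rightarrow> ('f, 'q, 'p) inference) \<Rightarrow> ('s \<Rightarrow> 's list) \<Rightarrow> nat \<Rightarrow> ('s \<rightharpoonup> nat list) \<Rightarrow>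
     nat list \<Rightarrow> 's \<Rightarrow> ('f, 'q, 'p) deriv" where
  "unfold_tree I N 0 h a q = Bud (concl (I q)) (the (h q))"
| "unfold_tree I N (Suc n) h a q = (case h q of Some c \<Rightarrow> Bud (concl (I q)) c
     | None \<Rightarrow> Infer (I q)
         (map (\<lambda>k. unfold_tree I N n (h(q \<mapsto> a)) (a @ [k]) (N q ! k)) [0..<length (N q)]))"

primrec walk :: "('s \<Rightarrow> 's list) \<Rightarrow> 's \<Rightarrow> nat list \<Rightarrow> 's" where
  "walk N q [] = q"
| "walk N q (k # v) = walk N (N q ! k) v"

lemma walk_snoc: "walk N q (v @ [k]) = N (walk N q v) ! k"
  by (induction v arbitrary: q) auto

lemma sequent_of_unfold_tree: "sequent_of (unfold_tree I N n h a q) = concl (I q)"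
  by (cases n) (auto split: option.split)

lemma subtree_append: "subtree D (v @ w) = Option.bind (subtree D v) (\<lambda>d. subtree d w)"
  by (induction D v rule: subtree.induct) auto

text \<open>A bud points either to an address recorded in \<open>h\<close> before the descent or to
  a node passed since then on its own branch. The fuel lasts because each inference records a new
  state, so the number of unvisited states drops together with \<open>n\<close>.\<close>

lemma subtree_unfold_tree:
  assumes "finite Q" "\<And>q. q \<in> Q \<Longrightarrow> set (N q) \<subseteq> Q"
  shows "\<lbrakk>q \<in> Q; dom h \<subseteq> Q; card (Q - dom h) < n; subtree (unfold_tree I N n h a q) v = Some d\<rbrakk> \<Longrightarrow>
    walk N q v \<in> Q \<and>
    (case d of Infer i ds \<Rightarrow> i = I (walk N q v) \<and> 
        map sequent_of ds = map (concl \<circ> I) (N (walk N q v))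
     | Bud S c \<Rightarrow> S = concl (I (walk N q v)) \<and>
        (h (walk N q v) = Some c \<or> (\<exists>w k u. v = w @ k # u \<and> c = a @ w \<and> walk N q w = walk N q v)))"
proof (induction v arbitrary: q h n a)
  case Nil
  then obtain n' where n: "n = Suc n'" by (cases n) auto
  show ?case
  proof (cases "h q")
    case None
    then show ?thesis using Nil n
      by (auto intro!: nth_equalityI simp: sequent_of_unfold_tree)
  next
    case (Some c)
    then show ?thesis using Nil n by auto
  qed
next
  case (Cons k v)
  then obtain n' where n: "n = Suc n'" by (cases n) auto
  show ?case
  proof (cases "h q")
    case None
    let ?h = "h(q \<mapsto> a)"
    have k: "k < length (N q)" 
      and sub: "subtree (unfold_tree I N n' ?h (a @ [k]) (N q ! k)) v = Some d"
      using Cons.prems(4) None n by (auto split: if_splits)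
    have "N q ! k \<in> Q"
      using assms(2)[OF Cons.prems(1)] k by auto
    moreover have "card (Q - dom ?h) < card (Q - dom h)"
      using None Cons.prems(1) assms(1) by (intro psubset_card_mono) (auto simp: dom_def)
    ultimately have IH: "walk N (N q ! k) v \<in> Q \<and>
      (case d of Infer i ds \<Rightarrow> i = I (walk N (N q ! k) v) \<and> 
          map sequent_of ds = map (concl \<circ> I) (N (walk N (N q ! k) v))
       | Bud S c \<Rightarrow> S = concl (I (walk N (N q ! k) v)) \<and>
        (?h (walk N (N q ! k) v) = Some c \<or>
         (\<exists>w l u. v = w @ l # u \<and> c = (a @ [k]) @ w \<and> walk N (N q ! k) w = walk N (N q ! k) v)))"
      using Cons.prems(1-3) n by (intro Cons.IH[OF _ _ _ sub]) (simp_all del: fun_upd_apply)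
    show ?thesis
    proof (cases d)
      case (Infer i ds)
      then show ?thesis using IH by simp
    next
      case (Bud S c)
      \<comment> \<open>The bud returns to the root of this tree, recorded at \<open>a\<close>, to a
        state recorded earlier in \<open>h\<close>, or to an inner node of the child's
        subtree.\<close>
      consider "walk N (N q ! k) v = q" "c = a" | "h (walk N (N q ! k) v) = Some c"
        | w l u where "v = w @ l # u" "c = (a @ [k]) @ w" "walk N (N q ! k) w = walk N (N q ! k) v"
        using IH Bud by (auto split: if_splits)
      then have "h (walk N q (k # v)) = Some c \<or>
        (\<exists>w l u. k # v = w @ l # u \<and> c = a @ w \<and> walk N q w = walk N q (k # v))"
      proof cases
        case 1
        then show ?thesis by (intro disjI2 exI[of _ "[]"]) auto
      next
        case 3
        then show ?thesis by (intro disjI2 exI[of _ "k # w"]) auto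
      qed auto
      then show ?thesis using IH Bud by simp
    qed
  next
    case (Some c)
    then show ?thesis using Cons.prems n by auto
  qed
qed

text \<open>Walking along an address assigns a state to each node of the tree. Bud and companion get
  the same state, so their sequents are equal, and an infinite path of \<open>D\<close> reads as a
  walk in the graph that pauses at buds.\<close>

lemma unfold_graph:
  fixes I :: "'s \<Rightarrow> ('f, 'q, 'p) inference"
  assumes "finite Q" "q\<^sub>0 \<in> Q" "\<And>q. q \<in> Q \<Longrightarrow> set (N q) \<subseteq> Q"
    and "\<And>q. q \<in> Q \<Longrightarrow> wf_inference \<Sigma> \<Phi> (I q)"
    and "\<And>q. q \<in> Q \<Longrightarrow> prems (I q) = map (concl \<circ> I) (N q)"
  obtains D s where "pre_proof \<Sigma> \<Phi> D" "sequent_of D = concl (I q\<^sub>0)"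
    "\<And>v d. subtree D v = Some d \<Longrightarrow> s v \<in> Q"
    "\<And>v i ds. subtree D v = Some (Infer i ds) \<Longrightarrow> i = I (s v) \<and> length ds = length (N (s v))"
    "\<And>v k. s (v @ [k]) = N (s v) ! k"
    "\<And>v S c. subtree D v = Some (Bud S c) \<Longrightarrow> s c = s v"
proof
  \<comment> \<open>With no state recorded at the root, one unit of fuel more than the number of
    states suffices, and every bud points to one of its own ancestors.\<close>
  define D where "D = unfold_tree I N (Suc (card Q)) Map.empty [] q\<^sub>0"
  define s where "s = walk N q\<^sub>0"
  have node: "s v \<in> Q \<and>
    (case d of Infer i ds \<Rightarrow> i = I (s v) \<and> map sequent_of ds = map (concl \<circ> I) (N (s v))
     | Bud S c \<Rightarrow> S = concl (I (s v)) \<and> (\<exists>k u. v = c @ k # u \<and> s c = s v))"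
    if "subtree D v = Some d" for v d
    using subtree_unfold_tree[where N = N and h = Map.empty and n = "Suc (card Q)" and a = "[]",
        OF assms(1,3,2) _ _ that[unfolded D_def]]
    by (cases d) (auto simp: s_def simp del: unfold_tree.simps)
  have bud: "\<exists>i ds. subtree D c = Some (Infer i ds) \<and> ds \<noteq> [] \<and> concl i = S"
    if b: "subtree D v = Some (Bud S c)" for v S c
  proof -
    obtain k u where v: "v = c @ k # u" "s c = s v" "S = concl (I (s v))"
      using node[OF b] by auto
    then obtain d where d: "subtree D c = Some d" "subtree d (k # u) = Some (Bud S c)"
      using b by (auto simp: subtree_append split: bind_splits)
    \<comment> \<open>The companion has a child numbered \<open>k\<close>, hence is no bud.\<close>
    then obtain i ds where "d = Infer i ds" "k < length ds"
      by (cases d) (auto split: if_splits)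
    then show ?thesis
      using d node[OF d(1)] v by auto
  qed
  show "pre_proof \<Sigma> \<Phi> D"
    unfolding pre_proof_def using node assms(4,5) bud by fastforce
  show "sequent_of D = concl (I q\<^sub>0)"
    by (simp only: D_def sequent_of_unfold_tree)
  show "s v \<in> Q" if "subtree D v = Some d" for v d
    using node[OF that] by blast
  show "i = I (s v) \<and> length ds = length (N (s v))" if "subtree D v = Some (Infer i ds)" for v i ds
    using node[OF that] by (auto dest: map_eq_imp_length_eq)
  show "s (v @ [k]) = N (s v) ! k" for v k
    by (simp add: s_def walk_snoc)
  show "s c = s v" if "subtree D v = Some (Bud S c)" for v S c
    using node[OF that] by auto
qed

text \<open>Segment \<open>n\<close> is laid out from position \<open>f n\<close> to
  \<open>f (Suc n)\<close>, and neighbours share an endpoint. Segments of length 0 are allowed, but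
  never two in a row, so the positions \<open>f n\<close> are unbounded.\<close>

lemma concat_segments:
  fixes l :: "nat \<Rightarrow> nat" and seg :: "nat \<Rightarrow> nat \<Rightarrow> 'a"
  assumes glue: "\<And>n. seg n (l n) = seg (Suc n) 0"
    and nonempty: "\<And>n. 0 < l n \<or> 0 < l (Suc n)"
  obtains x f where "mono f" "\<And>n. f (Suc n) = f n + l n" "\<And>j. \<exists>n. j \<le> f n"
    "\<And>n i. i \<le> l n \<Longrightarrow> x (f n + i) = seg n i"
    "\<And>j. \<exists>n i. i < l n \<and> j = f n + i"
proof
  define f where "f n = sum l {..<n}" for n
  \<comment> \<open>The least such \<open>n\<close> skips empty segments and is the one covering
    position \<open>j\<close>.\<close>
  define ix where "ix j = (LEAST n. j < f (Suc n))" for j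
  define x where "x j = seg (ix j) (j - f (ix j))" for j
  show fSuc: "f (Suc n) = f n + l n" for n
    by (simp add: f_def)
  show mono: "mono f"
    by (simp add: mono_iff_le_Suc fSuc)
  have grow: "f n < f (Suc (Suc n))" for n
    using nonempty[of n] by (auto simp: fSuc)
  \<comment> \<open>Two consecutive segments contribute at least one position.\<close>
  have ge: "j \<le> f (2 * j)" for j
  proof (induction j)
    case (Suc j)
    then show ?case using grow[of "2 * j"] by simp
  qed simp
  then show "\<exists>n. j \<le> f n" for j
    by blast
  have ex: "\<exists>n. j < f (Suc n)" for j
    using ge[of "Suc j"] monoD[OF mono, of "2 * Suc j" "Suc (2 * Suc j)"]
    by (intro exI[of _ "2 * Suc j"]) simp
  have ix: "j < f (Suc (ix j))" for j
    unfolding ix_def by (rule LeastI_ex[OF ex])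
  have ix_le: "f (ix j) \<le> j" for j
  proof (cases "ix j")
    case 0
    then show ?thesis by (simp add: f_def)
  next
    case (Suc m)
    then show ?thesis
      using not_less_Least[of m "\<lambda>n. j < f (Suc n)"] by (auto simp: ix_def)
  qed
  show "\<exists>n i. i < l n \<and> j = f n + i" for j
    using ix[of j] ix_le[of j] by (intro exI[of _ "ix j"] exI[of _ "j - f (ix j)"]) (auto simp: fSuc)
  have inner: "x (f n + i) = seg n i" if "i < l n" for n i
  proof -
    have "ix (f n + i) = n"
      unfolding ix_def
    proof (rule Least_equality)
      show "f n + i < f (Suc n)" using that by (simp add: fSuc)
      show "n \<le> m" if "f n + i < f (Suc m)" for m
        using that monoD[OF mono, of "Suc m" n] by (cases "n \<le> m") auto
    qed
    then show ?thesis by (simp add: x_def)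
  qed
  \<comment> \<open>The position of an empty segment belongs to the next one, which is
    nonempty.\<close>
  have start: "x (f n) = seg n 0" for n
  proof (cases "l n = 0")
    case True
    then have "x (f (Suc n) + 0) = seg (Suc n) 0"
      using inner[of 0 "Suc n"] nonempty[of n] by simp
    then show ?thesis using glue[of n] True by (simp add: fSuc)
  next
    case False
    then show ?thesis using inner[of 0 n] by simp
  qed
  show "x (f n + i) = seg n i" if "i \<le> l n" for n i
    using that inner[of i n] start[of "Suc n"] glue[of n] by (cases "i = l n") (auto simp: fSuc)
qed

section \<open>Eliminating Subst\<close>

lemma finite_nodes: "finite {v. subtree D v \<noteq> None}"
proof (induction D)
  case (Infer i ds)
  have "{v. subtree (Infer i ds) v \<noteq> None}
      \<subseteq> insert [] (\<Union>k < length ds. (#) k ` {v. subtree (ds ! k) v \<noteq> None})"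
  proof
    fix v assume "v \<in> {v. subtree (Infer i ds) v \<noteq> None}"
    then show "v \<in> insert [] (\<Union>k < length ds. (#) k ` {v. subtree (ds ! k) v \<noteq> None})"
      by (cases v) (auto split: if_splits)
  qed
  moreover have "finite (insert [] (\<Union>k < length ds. (#) k ` {v. subtree (ds ! k) v \<noteq> None}))"
    using Infer by simp
  ultimately show ?case
    by (rule finite_subset)
next
  case (Bud S c)
  have "{v. subtree (Bud S c) v \<noteq> None} \<subseteq> {[]}"
  proof
    fix v assume "v \<in> {v. subtree (Bud S c) v \<noteq> None}"
    then show "v \<in> {[]}" by (cases v) auto
  qed
  then show ?case by (rule finite_subset) simp
qed

lemma finite_inferences: "finite (inferences D)"
proof (rule finite_surj[OF finite_nodes])
  show "inferences D \<subseteq> (\<lambda>v. case the (subtree D v) of Infer i ds \<Rightarrow> i) ` {v. subtree D v \<noteq> None}"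
    by (force simp: inferences_def image_iff)
qed

lemma subtree_child:
  assumes "subtree D v = Some (Infer i ds)" "k < length ds"
  shows "subtree D (v @ [k]) = Some (ds ! k)"
  using assms by (simp add: subtree_append)

text \<open>
  The pool \<open>V\<close> supplies eigenvariables; it is larger than the number of variables that can occur
  in an instance of a sequent of the proof under a substitution with range in \<open>A\<close>.
\<close>

locale atomic_clkid_proof =
  fixes \<Sigma> :: "('f, 'q, 'p) signature" and \<Phi> :: "('f, 'q, 'p) production set"
    and Pr :: "('f, 'q, 'p) deriv" and A :: "'f tm set" and F V :: "var set"
  assumes proof_Pr: "clkid_proof \<Sigma> \<Phi> Pr"
    and finite_A: "finite A"
    and A_atomic: "t \<in> A \<Longrightarrow> (\<exists>x. t = Var x) \<or> (\<exists>c. fun_ar \<Sigma> c = Some 0 \<and> t = Fun c [])"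
    and A_Subst: "Subst \<Gamma> \<Delta> \<sigma> \<in> inferences Pr \<Longrightarrow> fmran' \<sigma> \<subseteq> A"
    and V_A: "Var ` V \<subseteq> A"
    and F_V: "F \<subseteq> V" and zero_V: "0 \<in> V" and finite_V: "finite V"
    and F: "subtree Pr w = Some d \<Longrightarrow> fv_seq (sequent_of d) \<subseteq> F"
    and card_V: "card F < card V" "r \<in> \<Phi> \<Longrightarrow> card F + card (fv_prod r) < card V"
begin

text \<open>All free variables of sequents of \<open>Pr\<close> lie in \<open>F\<close>; giving the
  others the default \<open>Var 0\<close> leaves finitely many substitutions. The default is in
  \<open>A\<close> because \<open>0\<close> is in \<open>V\<close>.\<close>

definition restr :: "(var \<Rightarrow> 'f tm) \<Rightarrow> var \<Rightarrow> 'f tm" where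
  "restr \<theta> x = (if x \<in> F then \<theta> x else Var 0)"

definition pool_substs :: "(var \<Rightarrow> 'f tm) set" where
  "pool_substs = {\<theta>. \<forall>x. (x \<in> F \<longrightarrow> \<theta> x \<in> A) \<and> (x \<notin> F \<longrightarrow> \<theta> x = Var 0)}"

definition states :: "(nat list \<times> (var \<Rightarrow> 'f tm)) set" where
  "states = {w. subtree Pr w \<noteq> None} \<times> pool_substs"

definition seq :: "nat list \<times> (var \<Rightarrow> 'f tm) \<Rightarrow> ('f, 'q, 'p) sequent" where
  "seq q = sub_seq (snd q) (sequent_of (the (subtree Pr (fst q))))"

definition normal :: "nat list \<times> (var \<Rightarrow> 'f tm) \<Rightarrow> bool" where
  "normal q \<longleftrightarrow> (\<exists>i ds. subtree Pr (fst q) = Some (Infer i ds) \<and> rule_of i \<noteq> R_Subst)"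

text \<open>These steps disappear in the new proof: a \<open>Subst\<close> is absorbed by composing
  its substitution with the current one, a bud by passing to its companion. The last case is only a
  default.\<close>

definition advance :: "nat list \<times> (var \<Rightarrow> 'f tm) \<Rightarrow> nat list \<times> (var \<Rightarrow> 'f tm)" where
  "advance q = (case subtree Pr (fst q) of
     Some (Infer (Subst \<Gamma> \<Delta> \<sigma>) ds) \<Rightarrow> (fst q @ [0], restr (\<lambda>x. sub_tm (snd q) (sfun \<sigma> x)))
   | Some (Bud S c) \<Rightarrow> (c, snd q)
   | _ \<Rightarrow> q)"

definition delay :: "nat list \<times> (var \<Rightarrow> 'f tm) \<Rightarrow> nat" where
  "delay q = (LEAST k. normal ((advance ^^ k) q))"

definition normalize :: "nat list \<times> (var \<Rightarrow> 'f tm) \<Rightarrow> nat list \<times> (var \<Rightarrow> 'f tm)" where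
  "normalize q = (advance ^^ delay q) q"

definition is_inst where
  "is_inst q j \<theta>s \<longleftrightarrow> (\<exists>i ds. subtree Pr (fst q) = Some (Infer i ds) \<and>
     inference_instance \<Sigma> \<Phi> (snd q) i j \<theta>s \<and> (\<forall>\<eta> \<in> set \<theta>s. range \<eta> \<subseteq> A))"

text \<open>A fixed choice makes the inference and its premise substitutions depend on the state
  alone, so that repeated states can be closed into cycles.\<close>

definition inst ::
    "nat list \<times> (var \<Rightarrow> 'f tm) \<Rightarrow> ('f, 'q, 'p) inference \<times> (var \<Rightarrow> 'f tm) list" where
  "inst q = (SOME p. is_inst q (fst p) (snd p))"

definition child :: "nat list \<times> (var \<Rightarrow> 'f tm) \<Rightarrow> nat \<Rightarrow> nat list \<times> (var \<Rightarrow> 'f tm)" where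
  "child q k = (fst q @ [k], restr (snd (inst q) ! k))"

definition successors ::
    "nat list \<times> (var \<Rightarrow> 'f tm) \<Rightarrow> (nat list \<times> (var \<Rightarrow> 'f tm)) list" where
  "successors q = map (\<lambda>k. normalize (child q k)) [0..<length (snd (inst q))]"

section \<open>Properties of states and of the steps between them\<close>

lemma A_wf: "t \<in> A \<Longrightarrow> wf_tm \<Sigma> 0 t" and A_card: "t \<in> A \<Longrightarrow> card (fv_tm t) \<le> 1"
  using A_atomic[of t] by auto

lemma pre_proof_Pr: "pre_proof \<Sigma> \<Phi> Pr"
  using proof_Pr by (simp add: clkid_proof_def)

lemma Var_A: "x \<in> V \<Longrightarrow> Var x \<in> A"
  using V_A by auto

lemma pool_substs_A: "\<theta> \<in> pool_substs \<Longrightarrow> \<theta> x \<in> A"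
  using zero_V Var_A by (cases "x \<in> F") (auto simp: pool_substs_def)

lemma restr_pool: "(\<And>x. x \<in> F \<Longrightarrow> \<theta> x \<in> A) \<Longrightarrow> restr \<theta> \<in> pool_substs"
  by (auto simp: restr_def pool_substs_def)

lemma finite_states: "finite states"
proof -
  have "finite F"
    using F_V finite_V by (rule finite_subset)
  then have "finite pool_substs"
    unfolding pool_substs_def using finite_A by (rule finite_set_of_finite_funs)
  then show ?thesis
    unfolding states_def by (intro finite_cartesian_product finite_nodes)
qed

lemma sub_seq_restr:
  "subtree Pr w = Some d \<Longrightarrow> sub_seq (restr \<theta>) (sequent_of d) = sub_seq \<theta> (sequent_of d)"
  using F by (intro sub_seq_cong) (auto simp: restr_def)

lemma sub_restr:
  assumes "subtree Pr w = Some d" "C \<in> fst (sequent_of d)"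
  shows "sub (restr \<theta>) C = sub \<theta> C"
  using F[OF assms(1)] assms(2)
  by (intro sub_cong) (force simp: restr_def fv_seq_def fv_set_def)

lemma node_wf_inference: "subtree Pr w = Some (Infer i ds) \<Longrightarrow> wf_inference \<Sigma> \<Phi> i"
  and node_prems: "subtree Pr w = Some (Infer i ds) \<Longrightarrow> map sequent_of ds = prems i"
  using pre_proof_Pr unfolding pre_proof_def by blast+

lemma bud_companion:
  "subtree Pr w = Some (Bud S c) \<Longrightarrow> \<exists>i ds. subtree Pr c = Some (Infer i ds) \<and> concl i = S"
  using pre_proof_Pr unfolding pre_proof_def by blast

text \<open>Applying \<open>\<theta>\<close> after \<open>\<sigma>\<close> is applying the
  composite, so the sequent is preserved. A trace step at \<open>Subst\<close> has
  \<open>C = C'[\<sigma>]\<close>, hence the instantiated atom stays the same too. Neither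
  \<open>Subst\<close> nor a bud unfolds an atom.\<close>

lemma advance:
  assumes q: "q \<in> states" and not_normal: "\<not> normal q"
  shows advance_states: "advance q \<in> states"
    and seq_advance: "seq (advance q) = seq q"
    and edge_advance: "edge Pr (fst q) (fst (advance q))"
    and trace_edge_advance: "trace_edge Pr (fst q) (fst (advance q)) C C'
      \<Longrightarrow> sub (snd (advance q)) C' = sub (snd q) C"
    and not_progress_advance: "\<not> progress_edge Pr (fst q) (fst (advance q)) C C'"
proof -
  obtain w \<theta> where w\<theta>: "q = (w, \<theta>)" by force
  obtain d where d: "subtree Pr w = Some d" and \<theta>: "\<theta> \<in> pool_substs"
    using q by (auto simp: w\<theta> states_def)
  have "advance q \<in> states \<and> seq (advance q) = seq q \<and> edge Pr (fst q) (fst (advance q)) \<and>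
    (trace_edge Pr (fst q) (fst (advance q)) C C' \<longrightarrow> sub (snd (advance q)) C' = sub (snd q) C) \<and>
    \<not> progress_edge Pr (fst q) (fst (advance q)) C C'"
  proof (cases d)
    case (Infer i ds)
    then have "rule_of i = R_Subst"
      using not_normal d by (auto simp: normal_def w\<theta>)
    then obtain \<Gamma> \<Delta> \<sigma> where i: "i = Subst \<Gamma> \<Delta> \<sigma>"
      by (cases i) auto
    have "map sequent_of ds = [(\<Gamma>, \<Delta>)]"
      using node_prems d Infer i by simp
    then obtain d' where ds: "ds = [d']" and d': "sequent_of d' = (\<Gamma>, \<Delta>)"
      by auto
    have sub': "subtree Pr (w @ [0]) = Some d'"
      using subtree_child[of Pr w i ds 0] d Infer ds by simp
    let ?\<theta> = "\<lambda>x. sub_tm \<theta> (sfun \<sigma> x)"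
    have adv: "advance q = (w @ [0], restr ?\<theta>)"
      by (simp add: advance_def w\<theta> d Infer i)
    have "Subst \<Gamma> \<Delta> \<sigma> \<in> inferences Pr"
      using d Infer i by (auto simp: inferences_def)
    then have ran: "fmran' \<sigma> \<subseteq> A"
      by (rule A_Subst)
    \<comment> \<open>Atomicity enters here: \<open>\<theta>\<close> sends a variable in the image
      of \<open>\<sigma>\<close> into \<open>A\<close>, while a constant is unchanged and was in
      \<open>A\<close> already.\<close>
    have "?\<theta> x \<in> A" for x
    proof (cases "fmlookup \<sigma> x")
      case None
      then show ?thesis using pool_substs_A[OF \<theta>] by (simp add: sfun_def)
    next
      case (Some t)
      then have "t \<in> A" using ran by (auto intro: fmran'I)
      then show ?thesis
        using A_atomic[of t] pool_substs_A[OF \<theta>] Some by (auto simp: sfun_def)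
    qed
    then have "restr ?\<theta> \<in> pool_substs"
      by (intro restr_pool)
    moreover have "sub_seq ?\<theta> (\<Gamma>, \<Delta>) = sub_seq \<theta> (concl i)"
      by (simp add: sub_seq_def i image_image sub_comp)
    moreover have "sub (restr ?\<theta>) C' = sub \<theta> C" if "trace_step i 0 C C'"
      using that sub_restr[OF sub', of C'] d' by (auto simp: i sub_comp)
    ultimately show ?thesis
      using d Infer ds d' sub' sub_seq_restr[OF sub', of ?\<theta>] unfolding adv
      by (auto simp: states_def seq_def edge_def trace_edge_def progress_edge_def w\<theta> i)
  next
    case (Bud S c)
    then show ?thesis
      using d \<theta> bud_companion[of w S c]
      by (auto simp: advance_def states_def seq_def edge_def trace_edge_def progress_edge_def w\<theta>)
  qed
  then show "advance q \<in> states" "seq (advance q) = seq q" "edge Pr (fst q) (fst (advance q))"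
    "trace_edge Pr (fst q) (fst (advance q)) C C' \<Longrightarrow> sub (snd (advance q)) C' = sub (snd q) C"
    "\<not> progress_edge Pr (fst q) (fst (advance q)) C C'"
    by blast+
qed

text \<open>Otherwise advancing forever would follow an infinite path of \<open>Pr\<close> on which
  nothing progresses, against the global trace condition. Hence \<open>delay\<close> is well defined
  on states.\<close>

lemma ex_normal:
  assumes "q \<in> states"
  shows "\<exists>k. normal ((advance ^^ k) q)"
proof (rule ccontr)
  assume "\<nexists>k. normal ((advance ^^ k) q)"
  then have nn: "\<not> normal ((advance ^^ k) q)" for k
    by blast
  have st: "(advance ^^ k) q \<in> states" for k
    by (induction k) (use assms nn advance_states in auto)
  let ?v = "\<lambda>k. fst ((advance ^^ k) q)"
  have "infinite_path Pr ?v"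
    unfolding infinite_path_def using edge_advance[OF st nn] by simp
  then obtain m C where "infinitely_progressing Pr (\<lambda>n. ?v (m + n)) C"
    using proof_Pr by (auto simp: clkid_proof_def global_trace_condition_def)
  moreover have "\<not> progress_edge Pr (?v (m + n)) (?v (m + Suc n)) (C n) (C (Suc n))" for n
    using not_progress_advance[OF st nn, of "m + n"] by simp
  ultimately show False
    by (auto simp: infinitely_progressing_def dest: INFM_EX)
qed

lemma advance_before_delay: "i < delay q \<Longrightarrow> \<not> normal ((advance ^^ i) q)"
  unfolding delay_def by (rule not_less_Least)

lemma funpow_advance:
  assumes "q \<in> states" "i \<le> delay q"
  shows "(advance ^^ i) q \<in> states \<and> seq ((advance ^^ i) q) = seq q"
  using assms(2)
proof (induction i)
  case (Suc i)
  then show ?case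
    using advance_before_delay[of i q] advance_states seq_advance by simp
qed (use assms in simp)

lemma normalize:
  assumes "q \<in> states"
  shows normalize_states: "normalize q \<in> states" and normal_normalize: "normal (normalize q)"
    and seq_normalize: "seq (normalize q) = seq q"
proof -
  show "normalize q \<in> states" "seq (normalize q) = seq q"
    using funpow_advance[OF assms order_refl] by (auto simp: normalize_def)
  show "normal (normalize q)"
    unfolding normalize_def delay_def by (rule LeastI_ex[OF ex_normal[OF assms]])
qed

text \<open>The variables of the conclusion lie in \<open>F\<close>, so the pool bounds provide an
  instance and the choice in \<open>inst\<close> succeeds.\<close>

lemma inst:
  assumes q: "q \<in> states" and i: "subtree Pr (fst q) = Some (Infer i ds)" and ns: "rule_of i \<noteq> R_Subst"
  shows inference_instance_inst: "inference_instance \<Sigma> \<Phi> (snd q) i (fst (inst q)) (snd (inst q))"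
    and inst_A: "\<eta> \<in> set (snd (inst q)) \<Longrightarrow> \<eta> x \<in> A"
proof -
  have \<theta>: "snd q x \<in> A" for x
    using q pool_substs_A by (auto simp: states_def)
  have wf: "wf_inference \<Sigma> \<Phi> i"
    using node_wf_inference[OF i] .
  have "card (fv_seq (concl i)) \<le> card F"
    using F[OF i] F_V finite_V by (auto intro!: card_mono dest: finite_subset)
  then have "\<exists>j \<theta>s. inference_instance \<Sigma> \<Phi> (snd q) i j \<theta>s \<and> (\<forall>\<eta> \<in> set \<theta>s. range \<eta> \<subseteq> A)"
    using card_V \<theta> A_wf A_card V_A finite_V
    by (intro ex_inference_instance[OF wf ns, where V = V])
      (auto intro: le_less_trans add_right_mono)
  then have "\<exists>p. is_inst q (fst p) (snd p)"
    using i by (auto simp: is_inst_def)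
  then have "is_inst q (fst (inst q)) (snd (inst q))"
    unfolding inst_def by (rule someI_ex)
  then show "inference_instance \<Sigma> \<Phi> (snd q) i (fst (inst q)) (snd (inst q))"
    "\<eta> \<in> set (snd (inst q)) \<Longrightarrow> \<eta> x \<in> A"
    using i by (auto simp: is_inst_def)
qed

text \<open>Restricting the premise substitution is harmless, as the formulas of the premise have
  their variables in \<open>F\<close>. Trace and progress steps then carry over from
  \<open>inference_instance\<close>.\<close>

lemma child:
  assumes q: "q \<in> states" "normal q" and k: "k < length (snd (inst q))"
  shows child_states: "child q k \<in> states"
    and seq_child: "seq (child q k) = prems (fst (inst q)) ! k"
    and edge_child: "edge Pr (fst q) (fst (child q k))"
    and trace_step_child: "\<lbrakk>ind_atom_at Pr (fst q) C; ind_atom_at Pr (fst (child q k)) C';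
        trace_edge Pr (fst q) (fst (child q k)) C C'\<rbrakk>
      \<Longrightarrow> trace_step (fst (inst q)) k (sub (snd q) C) (sub (snd (child q k)) C')"
    and progress_step_child: "\<lbrakk>ind_atom_at Pr (fst q) C; ind_atom_at Pr (fst (child q k)) C';
        progress_edge Pr (fst q) (fst (child q k)) C C'\<rbrakk>
      \<Longrightarrow> progress_step (fst (inst q)) k (sub (snd q) C) (sub (snd (child q k)) C')"
proof -
  obtain i ds where i: "subtree Pr (fst q) = Some (Infer i ds)" "rule_of i \<noteq> R_Subst"
    using q(2) by (auto simp: normal_def)
  note inst' = inference_instance_inst[OF q(1) i]
  have len: "length (snd (inst q)) = length ds" "k < length ds"
    using inst' k arg_cong[OF node_prems[OF i(1)], of length]
    by (auto simp: inference_instance_def)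
  have sub': "subtree Pr (fst q @ [k]) = Some (ds ! k)"
    using subtree_child[OF i(1) len(2)] .
  have ds_k: "sequent_of (ds ! k) = prems i ! k"
    using node_prems[OF i(1)] len(2) by (metis nth_map)
  show "child q k \<in> states"
    using inst_A[OF q(1) i] k sub' by (auto simp: child_def states_def intro!: restr_pool)
  show "seq (child q k) = prems (fst (inst q)) ! k"
    using inst' k sub' sub_seq_restr[OF sub'] ds_k by (simp add: inference_instance_def child_def seq_def)
  show "edge Pr (fst q) (fst (child q k))"
    using i(1) len(2) by (auto simp: child_def edge_def)
  assume C: "ind_atom_at Pr (fst q) C" and C': "ind_atom_at Pr (fst (child q k)) C'"
  have C_i: "C \<in> fst (concl i)"
    using C i(1) by (auto simp: ind_atom_at_def)
  have r: "sub (snd (child q k)) C' = sub (snd (inst q) ! k) C'"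
    using sub_restr[OF sub', of C'] C' sub' by (auto simp: child_def ind_atom_at_def)
  show "trace_step (fst (inst q)) k (sub (snd q) C) (sub (snd (child q k)) C')"
    if "trace_edge Pr (fst q) (fst (child q k)) C C'"
    unfolding r using that inst' i(1) C_i k
    by (auto simp: trace_edge_def child_def inference_instance_def)
  show "progress_step (fst (inst q)) k (sub (snd q) C) (sub (snd (child q k)) C')"
    if "progress_edge Pr (fst q) (fst (child q k)) C C'"
    unfolding r using that inst' i(1) C_i k
    by (auto simp: progress_edge_def child_def inference_instance_def)
qed

lemma concl_inst:
  assumes "q \<in> states" "normal q"
  shows "concl (fst (inst q)) = seq q" "wf_inference \<Sigma> \<Phi> (fst (inst q))"
    and "length (prems (fst (inst q))) = length (snd (inst q))"
    and "rule_of (fst (inst q)) \<in> rules_used Pr - {R_Subst}"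
proof -
  obtain i ds where i: "subtree Pr (fst q) = Some (Infer i ds)" "rule_of i \<noteq> R_Subst"
    using assms(2) by (auto simp: normal_def)
  show "concl (fst (inst q)) = seq q" "wf_inference \<Sigma> \<Phi> (fst (inst q))"
    "length (prems (fst (inst q))) = length (snd (inst q))"
    "rule_of (fst (inst q)) \<in> rules_used Pr - {R_Subst}"
    using inference_instance_inst[OF assms(1) i] i
    by (auto simp: inference_instance_def seq_def rules_used_def inferences_def)
qed

text \<open>Normalizing preserves the sequent, so the inference at each successor concludes exactly
  the corresponding premise. The normal states thus form a graph to which
  \<open>unfold_graph\<close> applies.\<close>

lemma successors:
  assumes "q \<in> states" "normal q"
  shows "set (successors q) \<subseteq> {q \<in> states. normal q}"
    and "prems (fst (inst q)) = map (concl \<circ> (\<lambda>q. fst (inst q))) (successors q)"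
proof -
  have "normalize (child q k) \<in> states \<and> normal (normalize (child q k)) \<and>
      concl (fst (inst (normalize (child q k)))) = prems (fst (inst q)) ! k"
    if "k < length (snd (inst q))" for k
  proof -
    note st = child_states[OF assms that]
    then show ?thesis
      using seq_child[OF assms that] concl_inst(1) normalize_states[OF st] normal_normalize[OF st]
        seq_normalize[OF st] by simp
  qed
  then show "set (successors q) \<subseteq> {q \<in> states. normal q}"
    "prems (fst (inst q)) = map (concl \<circ> (\<lambda>q. fst (inst q))) (successors q)"
    using concl_inst(3)[OF assms] by (auto simp: successors_def intro!: nth_equalityI)
qed

text \<open>A step of \<open>D\<close> at an inference becomes one step of \<open>Pr\<close> into a
  premise followed by \<open>delay\<close> many \<open>Subst\<close> and bud steps; a step at a bud
  becomes no step at all. The progressing trace of the resulting path, instantiated and sampled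
  where the steps of \<open>D\<close> begin, is the required one.\<close>

lemma global_trace_condition_unfolding:
  assumes pre: "pre_proof \<Sigma> \<Phi> D"
    and s: "\<And>v d. subtree D v = Some d \<Longrightarrow> s v \<in> states \<and> normal (s v)"
    and s_Infer: "\<And>v i ds. subtree D v = Some (Infer i ds)
      \<Longrightarrow> i = fst (inst (s v)) \<and> length ds = length (successors (s v))"
    and s_snoc: "\<And>v k. s (v @ [k]) = successors (s v) ! k"
    and s_Bud: "\<And>v S c. subtree D v = Some (Bud S c) \<Longrightarrow> s c = s v"
  shows "global_trace_condition D"
  unfolding global_trace_condition_def
proof (intro allI impI)
  fix v assume "infinite_path D v"
  then have edge: "edge D (v n) (v (Suc n))" for n
    by (simp add: infinite_path_def)
  define bud where "bud n \<longleftrightarrow> (\<exists>S c. subtree D (v n) = Some (Bud S c))" for n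
  have bud: "\<exists>S. subtree D (v n) = Some (Bud S (v (Suc n)))" if "bud n" for n
    using edge[of n] that by (auto simp: edge_def bud_def)
  have s_stutter: "s (v (Suc n)) = s (v n)" if "bud n" for n
    using bud[OF that] s_Bud by auto
  \<comment> \<open>At an inference the last entry of the next address is the number of the premise
    that the path enters.\<close>
  define \<kappa> where "\<kappa> n = last (v (Suc n))" for n
  have infer: "\<exists>ds. subtree D (v n) = Some (Infer (fst (inst (s (v n)))) ds) \<and> \<kappa> n < length ds \<and>
      v (Suc n) = v n @ [\<kappa> n] \<and> \<kappa> n < length (snd (inst (s (v n))))" if "\<not> bud n" for n
    using edge[of n] that s_Infer[of "v n"]
    by (fastforce simp: edge_def bud_def \<kappa>_def successors_def)
  have sv: "s (v n) \<in> states" "normal (s (v n))" for n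
    using s edge[of n] by (auto simp: edge_def)
  let ?child = "\<lambda>n. child (s (v n)) (\<kappa> n)"
  have child_st: "?child n \<in> states" if "\<not> bud n" for n
    using child_states[OF sv] infer[OF that] by blast
  \<comment> \<open>The successor counts the step into the premise, before the advances; at a bud
    the path in \<open>Pr\<close> stands still.\<close>
  define l where "l n = (if bud n then 0 else Suc (delay (?child n)))" for n
  define seg where "seg n i = (case i of 0 \<Rightarrow> s (v n) | Suc i \<Rightarrow> (advance ^^ i) (?child n))" for n i
  have glue: "seg n (l n) = seg (Suc n) 0" for n
  proof (cases "bud n")
    case True
    then show ?thesis using s_stutter by (simp add: seg_def l_def)
  next
    case False
    then show ?thesis
      using infer[OF False] s_snoc[of "v n" "\<kappa> n"]
      by (auto simp: seg_def l_def successors_def normalize_def)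
  qed
  have nonempty: "0 < l n \<or> 0 < l (Suc n)" for n
  proof (cases "bud n")
    case True
    then obtain S where "subtree D (v n) = Some (Bud S (v (Suc n)))"
      using bud by blast
    \<comment> \<open>A companion is an inference, never a bud.\<close>
    then have "\<not> bud (Suc n)"
      using pre unfolding pre_proof_def bud_def by fastforce
    then show ?thesis by (simp add: l_def)
  qed (simp add: l_def)
  obtain x f where mono: "mono f"
    and fSuc: "\<And>n. f (Suc n) = f n + l n" and unbounded: "\<And>j. \<exists>n. j \<le> f n"
    and x: "\<And>n i. i \<le> l n \<Longrightarrow> x (f n + i) = seg n i"
    and j: "\<And>j. \<exists>n i. i < l n \<and> j = f n + i"
    by (rule concat_segments[of seg l, OF glue nonempty], rule that)
  have x_f: "x (f n) = s (v n)" for n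
    using x[of 0 n] by (simp add: seg_def)
  have x_child: "x (Suc (f n)) = ?child n" if "\<not> bud n" for n
    using x[of 1 n] that by (simp add: seg_def l_def)
  have x_advance: "x (f n + Suc i) \<in> states" "\<not> normal (x (f n + Suc i))"
      "x (Suc (f n + Suc i)) = advance (x (f n + Suc i))"
    if "\<not> bud n" "i < delay (?child n)" for n i
    using x[of "Suc i" n] x[of "Suc (Suc i)" n] that funpow_advance[OF child_st[OF that(1)], of i]
      advance_before_delay[of i] by (auto simp: seg_def l_def)
  have step: "(\<exists>n. \<not> bud n \<and> j = f n) \<or>
      x j \<in> states \<and> \<not> normal (x j) \<and> x (Suc j) = advance (x j)" for j
  proof -
    obtain n i where n: "i < l n" "j = f n + i"
      using j by blast
    then have "\<not> bud n" by (auto simp: l_def)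
    then show ?thesis
      using n x_advance[of n "i - 1"] by (cases i) (auto simp: l_def)
  qed
  have "infinite_path Pr (\<lambda>j. fst (x j))"
    unfolding infinite_path_def
  proof
    fix j
    from step[of j] show "edge Pr (fst (x j)) (fst (x (Suc j)))"
    proof (elim disjE exE conjE)
      fix n assume n: "\<not> bud n" "j = f n"
      then show ?thesis
        using edge_child[OF sv, of "\<kappa> n" n] infer[of n] by (auto simp: x_f x_child)
    qed (use edge_advance in auto)
  qed
  then obtain m C where tr: "trace Pr (\<lambda>n. fst (x (m + n))) C"
    and prog: "infinitely_progressing Pr (\<lambda>n. fst (x (m + n))) C"
    using proof_Pr unfolding clkid_proof_def global_trace_condition_def by blast
  \<comment> \<open>Shifts the trace to the numbering of \<open>x\<close>; by truncated subtraction
    the values before \<open>m\<close> are dummies.\<close>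
  let ?C = "\<lambda>j. C (j - m)"
  have atom: "ind_atom_at Pr (fst (x j)) (?C j)"
    and tr_edge: "trace_edge Pr (fst (x j)) (fst (x (Suc j))) (?C j) (?C (Suc j))" if "m \<le> j" for j
    using tr that by (auto simp: trace_def Suc_diff_le dest: spec[of _ "j - m"])
  \<comment> \<open>The atom as it reads in \<open>D\<close>; advancing changes atom and
    substitution but not this instance.\<close>
  define val where "val j = sub (snd (x j)) (?C j)" for j
  have val_Suc: "val (Suc j) = val j"
    if "m \<le> j" "x j \<in> states" "\<not> normal (x j)" "x (Suc j) = advance (x j)" for j
    using trace_edge_advance[OF that(2,3)] tr_edge[OF that(1)] that(4) by (simp add: val_def)
  have val_seg: "val (f (Suc n)) = val (Suc (f n))" if "m \<le> f n" "\<not> bud n" for n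
  proof -
    have "i \<le> delay (?child n) \<Longrightarrow> val (f n + Suc i) = val (Suc (f n))" for i
    proof (induction i)
      case (Suc i)
      then show ?case
        using val_Suc[of "f n + Suc i"] x_advance[OF that(2), of i] that(1) by simp
    qed simp
    then show ?thesis
      using that(2) by (simp add: fSuc l_def)
  qed
  have val_trace: "trace_edge D (v n) (v (Suc n)) (val (f n)) (val (f (Suc n)))" if "m \<le> f n" for n
  proof (cases "bud n")
    case True
    then show ?thesis
      using bud[OF True] by (auto simp: trace_edge_def fSuc l_def)
  next
    case False
    then have "trace_step (fst (inst (s (v n)))) (\<kappa> n) (val (f n)) (val (Suc (f n)))"
      using trace_step_child[OF sv, of "\<kappa> n" n "?C (f n)" "?C (Suc (f n))"] infer[OF False]
        atom[OF that] atom[of "Suc (f n)"] tr_edge[OF that] that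
      by (auto simp: val_def x_f x_child)
    then show ?thesis
      using infer[OF False] val_seg[OF that False] by (auto simp: trace_edge_def)
  qed
  have val_progress: "progress_edge D (v n) (v (Suc n)) (val (f n)) (val (f (Suc n)))"
    if "m \<le> f n" "\<not> bud n"
      and "progress_edge Pr (fst (x (f n))) (fst (x (Suc (f n)))) (?C (f n)) (?C (Suc (f n)))" for n
  proof -
    have "progress_step (fst (inst (s (v n)))) (\<kappa> n) (val (f n)) (val (Suc (f n)))"
      using progress_step_child[OF sv, of "\<kappa> n" n "?C (f n)" "?C (Suc (f n))"] infer[OF that(2)]
        atom[OF that(1)] atom[of "Suc (f n)"] that
      by (auto simp: val_def x_f x_child)
    then show ?thesis
      using infer[OF that(2)] val_seg[OF that(1,2)] by (auto simp: progress_edge_def)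
  qed
  have val_atom: "ind_atom_at D (v n) (val (f n))" if mn: "m \<le> f n" for n
  proof -
    obtain p ts d where C: "?C (f n) = Ind p ts" "subtree Pr (fst (s (v n))) = Some d"
      "Ind p ts \<in> fst (sequent_of d)"
      using atom[OF mn] by (auto simp: ind_atom_at_def x_f)
    then have "val (f n) \<in> fst (seq (s (v n)))" "\<exists>p ts. val (f n) = Ind p ts"
      by (auto simp: seq_def sub_seq_def val_def x_f simp del: sub.simps) simp
    moreover have "seq (s (v n)) = concl (fst (inst (s (v n))))"
      using concl_inst(1)[OF sv] by simp
    \<comment> \<open>The sequent of a bud is the conclusion at its companion, which has the same
      state.\<close>
    moreover have "\<exists>d. subtree D (v n) = Some d \<and> sequent_of d = concl (fst (inst (s (v n))))"
    proof (cases "bud n")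
      case True
      then obtain S where "subtree D (v n) = Some (Bud S (v (Suc n)))"
        using bud by blast
      moreover from this obtain i ds where "subtree D (v (Suc n)) = Some (Infer i ds)" "concl i = S"
        using pre unfolding pre_proof_def by blast
      ultimately show ?thesis
        using s_Infer[of "v (Suc n)" i ds] s_stutter[OF True] by auto
    next
      case False
      then show ?thesis using infer[OF False] by auto
    qed
    ultimately show ?thesis by (auto simp: ind_atom_at_def)
  qed
  obtain m' where m': "m \<le> f m'"
    using unbounded by blast
  have m'n: "m \<le> f (m' + n)" for n
    using m' monoD[OF mono, of m' "m' + n"] by simp
  let ?E = "\<lambda>n. val (f (m' + n))"
  have "trace D (\<lambda>n. v (m' + n)) ?E"
    using val_trace[OF m'n] val_atom[OF m'n] by (simp add: trace_def)
  moreover have "infinitely_progressing D (\<lambda>n. v (m' + n)) ?E"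
    unfolding infinitely_progressing_def INFM_nat
  proof
    fix N
    obtain k where k: "f (m' + N) < k"
      "progress_edge Pr (fst (x (m + k))) (fst (x (m + Suc k))) (C k) (C (Suc k))"
      using prog unfolding infinitely_progressing_def INFM_nat by blast
    \<comment> \<open>Advancing never progresses, so the progressing position is the start of a step
      at an inference of \<open>D\<close>.\<close>
    have "\<exists>n. \<not> bud n \<and> m + k = f n"
      using step[of "m + k"]
    proof (elim disjE conjE)
      assume "x (m + k) \<in> states" "\<not> normal (x (m + k))" "x (Suc (m + k)) = advance (x (m + k))"
      then show ?thesis
        using not_progress_advance[of "x (m + k)" "C k" "C (Suc k)"] k(2) by simp
    qed
    then obtain n where n: "\<not> bud n" "m + k = f n" by blast
    \<comment> \<open>\<open>f\<close> is monotone and \<open>k\<close> was taken beyond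
      \<open>f (m' + N)\<close>.\<close>
    have "m' + N < n"
      using monoD[OF mono, of n "m' + N"] k(1) n(2) by (cases "m' + N < n") auto
    moreover have "progress_edge D (v n) (v (Suc n)) (val (f n)) (val (f (Suc n)))"
      using k(2) n(1) by (intro val_progress) (simp_all flip: n(2))
    ultimately show "\<exists>n>N. progress_edge D (v (m' + n)) (v (m' + Suc n)) (?E n) (?E (Suc n))"
      by (intro exI[of _ "n - m'"]) auto
  qed
  ultimately show "\<exists>m C. trace D (\<lambda>n. v (m + n)) C \<and> infinitely_progressing D (\<lambda>n. v (m + n)) C"
    by blast
qed

text \<open>The unfolding starts from the root under the identity. \<open>restr Var\<close> fixes
  the variables in \<open>F\<close>, so this state has the sequent of \<open>Pr\<close>, and
  normalizing preserves it.\<close>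

lemma ex_Subst_free_proof:
  "\<exists>D. clkid_proof \<Sigma> \<Phi> D \<and> sequent_of D = sequent_of Pr \<and> rules_used D \<subseteq> rules_used Pr - {R_Subst}"
proof -
  let ?I = "\<lambda>q. fst (inst q)" and ?Q = "{q \<in> states. normal q}"
  let ?r = "([], restr Var)"
  have r: "?r \<in> states"
    using F_V Var_A by (auto simp: states_def intro!: restr_pool)
  have seq_r: "seq ?r = sequent_of Pr"
    using sub_seq_restr[of "[]" Pr Var] by (simp add: seq_def sub_seq_def)
  have q\<^sub>0: "normalize ?r \<in> ?Q"
    using normalize_states[OF r] normal_normalize[OF r] by simp
  obtain D s where D: "pre_proof \<Sigma> \<Phi> D" "sequent_of D = concl (?I (normalize ?r))"
    and s: "\<And>v d. subtree D v = Some d \<Longrightarrow> s v \<in> ?Q"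
      "\<And>v i ds. subtree D v = Some (Infer i ds) \<Longrightarrow> i = ?I (s v) \<and> length ds = length (successors (s v))"
      "\<And>v k. s (v @ [k]) = successors (s v) ! k"
      "\<And>v S c. subtree D v = Some (Bud S c) \<Longrightarrow> s c = s v"
    using unfold_graph[of ?Q "normalize ?r" successors \<Sigma> \<Phi> ?I] q\<^sub>0 finite_states concl_inst(2) successors
    by auto
  have "global_trace_condition D"
    using s by (intro global_trace_condition_unfolding[OF D(1), of s]) auto
  moreover have "sequent_of D = sequent_of Pr"
    using D(2) concl_inst(1) q\<^sub>0 seq_normalize[OF r] seq_r by simp
  moreover have "rules_used D \<subseteq> rules_used Pr - {R_Subst}"
  proof
    fix \<rho> assume "\<rho> \<in> rules_used D"
    then obtain v i ds where v: "subtree D v = Some (Infer i ds)" "\<rho> = rule_of i"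
      by (auto simp: rules_used_def inferences_def)
    then show "\<rho> \<in> rules_used Pr - {R_Subst}"
      using s(1,2)[OF v(1)] concl_inst(4)[of "s v"] by simp
  qed
  ultimately show ?thesis
    using D(1) unfolding clkid_proof_def by blast
qed

end

section \<open>Choice of the finite sets for a given proof\<close>

theorem theorem3:
  fixes \<Sigma> :: "('f, 'q, 'p) signature"
    and \<Phi> :: "('f, 'q, 'p) production set"
    and Pr :: "('f, 'q, 'p) deriv"
    and \<Gamma> \<Delta> :: "('f, 'q, 'p) fm set"
  assumes "inductive_definition_set \<Sigma> \<Phi>"
    and "clkid_proof_of \<Sigma> \<Phi> Pr \<Gamma> \<Delta>"
    and "\<And>\<Gamma>' \<Delta>' \<theta>. Subst \<Gamma>' \<Delta>' \<theta> \<in> inferences Pr \<Longrightarrow> atomic \<Sigma> \<theta>"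
  shows "\<exists>Pr'. clkid_proof_of \<Sigma> \<Phi> Pr' \<Gamma> \<Delta> \<and>
           R_Subst \<notin> rules_used Pr' \<and> rules_used Pr' \<subseteq> rules_used Pr"
proof -
  have Pr: "clkid_proof \<Sigma> \<Phi> Pr" "pre_proof \<Sigma> \<Phi> Pr" "sequent_of Pr = (\<Gamma>, \<Delta>)"
    using assms(2) by (auto simp: clkid_proof_of_def clkid_proof_def)
  define nodes where "nodes = {w. subtree Pr w \<noteq> None}"
  define F where "F = (\<Union>w \<in> nodes. fv_seq (sequent_of (the (subtree Pr w))))"
  have fin_nodes: "finite nodes"
    unfolding nodes_def by (rule finite_nodes)
  have infer_wf: "wf_sequent \<Sigma> (concl i)" if "subtree Pr w = Some (Infer i ds)" for w i ds
    using Pr(2) that unfolding pre_proof_def wf_inference_def by blast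
  \<comment> \<open>A bud inherits well-formedness from its companion.\<close>
  have wf: "wf_sequent \<Sigma> (sequent_of d)" if d: "subtree Pr w = Some d" for w d
  proof (cases d)
    case (Bud S c)
    then obtain i ds where "subtree Pr c = Some (Infer i ds)" "concl i = S"
      using Pr(2) d unfolding pre_proof_def by blast
    then show ?thesis using Bud infer_wf by auto
  qed (use infer_wf d in auto)
  have "finite F"
    using fin_nodes wf by (auto simp: F_def nodes_def fv_seq_def wf_sequent_def intro!: finite_fv_set)
  have fin\<Phi>: "finite \<Phi>"
    using assms(1) by (simp add: inductive_definition_set_def)
  \<comment> \<open>\<open>Max\<close> and the successor place \<open>0\<close> and all of
    \<open>F\<close> below \<open>N\<close>. The other summands make the pool exceed
    \<open>card F\<close> plus the number of variables of any one production, which the sum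
    bounds.\<close>
  define N where "N = Suc (Max (insert 0 F) + card F + (\<Sum>r \<in> \<Phi>. card (fv_prod r)))"
  define V where "V = {..<N}"
  \<comment> \<open>The terms introduced by the \<open>Subst\<close> steps of \<open>Pr\<close>,
    finitely many; with the pool variables they make up the set \<open>A\<close> of the
    locale.\<close>
  define images where "images = (\<Union>i \<in> inferences Pr. case i of Subst \<Gamma>' \<Delta>' \<sigma> \<Rightarrow> fmran' \<sigma> | _ \<Rightarrow> {})"
  have images: "fmran' \<sigma> \<subseteq> images" if "Subst \<Gamma>' \<Delta>' \<sigma> \<in> inferences Pr" for \<Gamma>' \<Delta>' \<sigma>
    by (auto simp: images_def intro!: bexI[OF _ that])
  have "atomic_clkid_proof \<Sigma> \<Phi> Pr (Var ` V \<union> images) F V"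
  proof
    show "finite (Var ` V \<union> images)"
      by (auto simp: images_def V_def fmran'_alt_def finite_inferences split: inference.split)
    show "(\<exists>x. t = Var x) \<or> (\<exists>c. fun_ar \<Sigma> c = Some 0 \<and> t = Fun c [])"
      if t: "t \<in> Var ` V \<union> images" for t
    proof (cases "t \<in> images")
      case True
      then obtain i where i: "i \<in> inferences Pr" "t \<in> (case i of Subst \<Gamma>' \<Delta>' \<sigma> \<Rightarrow> fmran' \<sigma> | _ \<Rightarrow> {})"
        by (auto simp: images_def)
      then obtain \<Gamma>' \<Delta>' \<sigma> where "i = Subst \<Gamma>' \<Delta>' \<sigma>" "t \<in> fmran' \<sigma>"
        by (cases i) auto
      then show ?thesis
        using assms(3)[of \<Gamma>' \<Delta>' \<sigma>] i(1) by (auto simp: atomic_def)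
    qed (use t in auto)
    show "F \<subseteq> V"
    proof
      fix x assume "x \<in> F"
      then have "x \<le> Max (insert 0 F)"
        using \<open>finite F\<close> by (intro Max_ge) auto
      then show "x \<in> V" by (simp add: V_def N_def)
    qed
    show "fv_seq (sequent_of d) \<subseteq> F" if "subtree Pr w = Some d" for w d
      using that by (force simp: F_def nodes_def)
    show "card F + card (fv_prod r) < card V" if "r \<in> \<Phi>" for r
      using member_le_sum[OF that, of "\<lambda>r. card (fv_prod r)"] fin\<Phi> by (simp add: V_def N_def)
    show "fmran' \<sigma> \<subseteq> Var ` V \<union> images" if "Subst \<Gamma>' \<Delta>' \<sigma> \<in> inferences Pr" for \<Gamma>' \<Delta>' \<sigma>
      using images[OF that] by blast
  qed (use Pr(1) in \<open>auto simp: V_def N_def\<close>)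
  then interpret atomic_clkid_proof \<Sigma> \<Phi> Pr "Var ` V \<union> images" F V .
  show ?thesis
    using ex_Subst_free_proof Pr(3) unfolding clkid_proof_of_def by auto
qed

end
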